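(* Let $\Omega$ be an open bounded convex subset of $\mathbb{R}^n$, and let $u \in C(\overline\Omega)$ be the (unique) viscosity solution of the Dirichlet problem $$-\Delta^N_\infty u = 1 \ \text{ in } \Omega, \qquad u = 0 \ \text{ on } \partial\Omega,$$ where $\Delta^N_\infty$ is the normalized infinity Laplacian. Then $u^{1/2}$ is concave in $\Omega$.
   Context: For functions $u, v\colon \Omega\to\mathbb{R}$ and $x\in\Omega$, $u \prec_x v$ means $u(x)=v(x)$ and $u(y)\le v(y)$ for every $y\in\Omega$. For a symmetric matrix $A$, $\lambda_{\min}(A)$ and $\lambda_{\max}(A)$ denote its minimum and maximum eigenvalues. For a $C^2$ function $\varphi$ near $x$, set $\Delta^+_\infty\varphi(x) = \Delta^-_\infty\varphi(x) = |\nabla\varphi(x)|^{-2}\langle \nabla^2\varphi(x)\nabla\varphi(x),\nabla\varphi(x)\rangle$ if $\nabla\varphi(x)\ne 0$, while $\Delta^+_\infty\varphi(x) = \lambda_{\max}(\nabla^2\varphi(x))$ and $\Delta^-_\infty\varphi(x)=\lambda_{\min}(\nabla^2\varphi(x))$ if $\nabla\varphi(x)=0$. Viscosity solutions of $-\Delta^N_\infty u = f(x)$ in $\Omega$ ($f$ continuous): an upper semicontinuous $u$ is a viscosity sub-solution if for every $x\in\Omega$ and every $\varphi\in C^2(\Omega)$ with $u\prec_x\varphi$ one has $-\Delta^+_\infty\varphi(x)\le f(x)$; a lower semicontinuous $u$ is a viscosity super-solution if for every $x\in\Omega$ and every $\varphi\in C^2(\Omega)$ with $\varphi\prec_x u$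 one has $-\Delta^-_\infty\varphi(x)\ge f(x)$; $u \in C(\Omega)$ is a viscosity solution if it is both. A viscosity solution of the Dirichlet problem is a function $u\in C(\overline\Omega)$ which is a viscosity solution of the equation in $\Omega$ and vanishes on $\partial\Omega$. It is known that the Dirichlet problem with $f\equiv 1$ has a unique viscosity solution and that this solution is strictly positive in $\Omega$, so $u^{1/2}$ is well defined. *)

theory Defs
  imports "HOL-Analysis.Analysis"
begin

definition touches_from_below ::
    "(real^'n) set \<Rightarrow> (real^'n \<Rightarrow> real) \<Rightarrow> real^'n \<Rightarrow> (real^'n \<Rightarrow> real) \<Rightarrow> bool" where
  "touches_from_below \<Omega> u x v \<longleftrightarrow> u x = v x \<and> (\<forall>y\<in>\<Omega>. u y \<le> v y)"

definition gradient :: "(real^'n \<Rightarrow> real) \<Rightarrow> real^'n \<Rightarrow> real^'n" where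
  "gradient \<phi> x = (\<chi> i. frechet_derivative \<phi> (at x) (axis i 1))"

definition hessian :: "(real^'n \<Rightarrow> real) \<Rightarrow> real^'n \<Rightarrow> real^'n^'n" where
  "hessian \<phi> x = jacobian (gradient \<phi>) (at x)"

(* Intended for open sets: derivatives are taken in the full space. *)
definition C2_on :: "(real^'n) set \<Rightarrow> (real^'n \<Rightarrow> real) \<Rightarrow> bool" where
  "C2_on \<Omega> \<phi> \<longleftrightarrow>
     (\<forall>x\<in>\<Omega>. \<phi> differentiable (at x)) \<and>
     (\<forall>x\<in>\<Omega>. gradient \<phi> differentiable (at x)) \<and>
     continuous_on \<Omega> (hessian \<phi>)"

definition is_eigenvalue :: "real^'n^'n \<Rightarrow> real \<Rightarrow> bool" where
  "is_eigenvalue A l \<longleftrightarrow> (\<exists>v. v \<noteq> 0 \<and> A *v v = l *\<^sub>R v)"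

(* Only used for symmetric A, whose set of real eigenvalues is finite and nonempty,
   so that Min and Max are genuine. *)
definition lambda_min :: "real^'n^'n \<Rightarrow> real" where
  "lambda_min A = Min {l. is_eigenvalue A l}"

definition lambda_max :: "real^'n^'n \<Rightarrow> real" where
  "lambda_max A = Max {l. is_eigenvalue A l}"

definition inf_laplacian_plus :: "(real^'n \<Rightarrow> real) \<Rightarrow> real^'n \<Rightarrow> real" where
  "inf_laplacian_plus \<phi> x =
     (if gradient \<phi> x \<noteq> 0
      then ((hessian \<phi> x *v gradient \<phi> x) \<bullet> gradient \<phi> x) / (norm (gradient \<phi> x))\<^sup>2
      else lambda_max (hessian \<phi> x))"

definition inf_laplacian_minus :: "(real^'n \<Rightarrow> real) \<Rightarrow> real^'n \<Rightarrow> real" where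
  "inf_laplacian_minus \<phi> x =
     (if gradient \<phi> x \<noteq> 0
      then ((hessian \<phi> x *v gradient \<phi> x) \<bullet> gradient \<phi> x) / (norm (gradient \<phi> x))\<^sup>2
      else lambda_min (hessian \<phi> x))"

definition usc_on :: "'a::topological_space set \<Rightarrow> ('a \<Rightarrow> real) \<Rightarrow> bool" where
  "usc_on S u \<longleftrightarrow> (\<forall>x\<in>S. \<forall>c. u x < c \<longrightarrow> (\<forall>\<^sub>F y in at x within S. u y < c))"

definition lsc_on :: "'a::topological_space set \<Rightarrow> ('a \<Rightarrow> real) \<Rightarrow> bool" where
  "lsc_on S u \<longleftrightarrow> (\<forall>x\<in>S. \<forall>c. c < u x \<longrightarrow> (\<forall>\<^sub>F y in at x within S. c < u y))"

(* The equation is - inf_laplacian u = f in \<Omega>, for continuous f. *)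
definition viscosity_subsolution ::
    "(real^'n) set \<Rightarrow> (real^'n \<Rightarrow> real) \<Rightarrow> (real^'n \<Rightarrow> real) \<Rightarrow> bool" where
  "viscosity_subsolution \<Omega> f u \<longleftrightarrow> usc_on \<Omega> u \<and>
     (\<forall>x\<in>\<Omega>. \<forall>\<phi>. C2_on \<Omega> \<phi> \<and> touches_from_below \<Omega> u x \<phi> \<longrightarrow> - inf_laplacian_plus \<phi> x \<le> f x)"

definition viscosity_supersolution ::
    "(real^'n) set \<Rightarrow> (real^'n \<Rightarrow> real) \<Rightarrow> (real^'n \<Rightarrow> real) \<Rightarrow> bool" where
  "viscosity_supersolution \<Omega> f u \<longleftrightarrow> lsc_on \<Omega> u \<and>
     (\<forall>x\<in>\<Omega>. \<forall>\<phi>. C2_on \<Omega> \<phi> \<and> touches_from_below \<Omega> \<phi> x u \<longrightarrow> - inf_laplacian_minus \<phi> x \<ge> f x)"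

definition viscosity_solution ::
    "(real^'n) set \<Rightarrow> (real^'n \<Rightarrow> real) \<Rightarrow> (real^'n \<Rightarrow> real) \<Rightarrow> bool" where
  "viscosity_solution \<Omega> f u \<longleftrightarrow> continuous_on \<Omega> u \<and>
     viscosity_subsolution \<Omega> f u \<and> viscosity_supersolution \<Omega> f u"

definition dirichlet_viscosity_solution ::
    "(real^'n) set \<Rightarrow> (real^'n \<Rightarrow> real) \<Rightarrow> (real^'n \<Rightarrow> real) \<Rightarrow> bool" where
  "dirichlet_viscosity_solution \<Omega> f u \<longleftrightarrow> continuous_on (closure \<Omega>) u \<and>
     viscosity_solution \<Omega> f u \<and> (\<forall>x\<in>frontier \<Omega>. u x = 0)"

end

theory Submission
  imports Defs
begin

text \<open>
  Write \<open>w = sqrt u\<close>, and let \<open>M \<rho> x\<close> and \<open>I \<rho> x\<close> be the supremum and infimum of \<open>u\<close> over the closed ball of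
  radius \<open>\<rho>\<close> about \<open>x\<close>. Comparison with radial parabolas shows that \<open>M \<rho> x + \<rho>^2/2\<close> is convex and
  \<open>I \<rho> x + \<rho>^2/2\<close> is concave in \<open>\<rho>\<close>; this one-dimensional information replaces the theorem on sums of
  viscosity theory. If \<open>w\<close> were not concave, then for some small \<open>r\<close> the function
  \<open>l * sqrt (M r x) + m * sqrt (M r y) - sqrt (I r (l x + m y))\<close> would have a positive maximum, with values
  \<open>a\<close>, \<open>b\<close>, \<open>c\<close> of the three roots and \<open>c < l a + m b\<close>. Enlarging the first two balls by \<open>a s\<close> and \<open>b s\<close> and
  shrinking the third by \<open>(l a + m b) s\<close> (for \<open>s\<close> of either sign) can be realised by moving the points, so
  it does not increase the function. Equality of the first derivatives makes the three supporting parabolas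
  rescalings of a single strictly concave function \<open>sqrt (1 + 2 P s - s^2/2)\<close>, a contradiction.
  For this the maximum has to be attained at interior points; if \<open>x\<close> lies on the boundary, the same argument is
  run with \<open>x\<close> fixed and only \<open>y\<close> moving.
\<close>

section \<open>Quadratic test functions and their infinity Laplacians\<close>

text \<open>
  The term with \<open>C\<close> does not affect the 2-jet at \<open>y\<close>; for large \<open>C\<close> it turns local touching into touching on
  all of \<open>\<Omega>\<close>, which the notion of viscosity solution demands.
\<close>

definition quartic :: "real \<Rightarrow> real^'n \<Rightarrow> real^'n \<Rightarrow> real \<Rightarrow> real \<Rightarrow> real \<Rightarrow> real^'n \<Rightarrow> real" where
  "quartic c y p \<alpha> \<beta> C z = c + p \<bullet> (z - y) + (\<alpha>/2) * (p \<bullet> (z - y))\<^sup>2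
     + (\<beta>/2) * ((z - y) \<bullet> (z - y)) + C * ((z - y) \<bullet> (z - y))\<^sup>2"

lemma quartic_has_derivative:
  "(quartic c y p \<alpha> \<beta> C has_derivative
     (\<lambda>v. (p + (\<alpha> * (p \<bullet> (z - y))) *\<^sub>R p + \<beta> *\<^sub>R (z - y) + (4 * C * ((z - y) \<bullet> (z - y))) *\<^sub>R (z - y)) \<bullet> v)) (at z)"
  unfolding quartic_def[abs_def]
  by (auto intro!: derivative_eq_intros simp: fun_eq_iff inner_add_left inner_add_right inner_commute algebra_simps diff_divide_distrib)

lemma gradient_quartic:
  "gradient (quartic c y p \<alpha> \<beta> C) =
     (\<lambda>z. p + (\<alpha> * (p \<bullet> (z - y))) *\<^sub>R p + \<beta> *\<^sub>R (z - y) + (4 * C * ((z - y) \<bullet> (z - y))) *\<^sub>R (z - y))"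
  unfolding gradient_def
  by (rule ext, subst frechet_derivative_at[OF quartic_has_derivative, symmetric])
     (simp add: vec_eq_iff inner_axis)

lemma gradient_quartic_has_derivative:
  "(gradient (quartic c y p \<alpha> \<beta> C) has_derivative
     (\<lambda>v. (\<alpha> * (p \<bullet> v)) *\<^sub>R p + \<beta> *\<^sub>R v + (4 * C * ((z - y) \<bullet> (z - y))) *\<^sub>R v
        + (8 * C * ((z - y) \<bullet> v)) *\<^sub>R (z - y))) (at z)"
  unfolding gradient_quartic
  by (auto intro!: derivative_eq_intros simp: fun_eq_iff inner_commute algebra_simps)

lemma hessian_quartic:
  "hessian (quartic c y p \<alpha> \<beta> C) z =
     matrix (\<lambda>v. (\<alpha> * (p \<bullet> v)) *\<^sub>R p + \<beta> *\<^sub>R v + (4 * C * ((z - y) \<bullet> (z - y))) *\<^sub>R v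
        + (8 * C * ((z - y) \<bullet> v)) *\<^sub>R (z - y))"
  unfolding hessian_def jacobian_def
  by (subst frechet_derivative_at[OF gradient_quartic_has_derivative, symmetric]) simp

lemma hessian_quartic_at_center:
  "hessian (quartic c y p \<alpha> \<beta> C) y *v v = (\<alpha> * (p \<bullet> v)) *\<^sub>R p + \<beta> *\<^sub>R v"
proof -
  have lin: "linear (\<lambda>v. (\<alpha> * (p \<bullet> v)) *\<^sub>R p + \<beta> *\<^sub>R v)"
    by (rule linearI) (auto simp: algebra_simps inner_add_right)
  show ?thesis
    using lin
    by (simp add: hessian_quartic matrix_works)
qed

lemma C2_on_quartic: "C2_on S (quartic c y p \<alpha> \<beta> C)"
  unfolding C2_on_def
proof (intro conjI ballI)
  fix z
  show "quartic c y p \<alpha> \<beta> C differentiable at z"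
    using quartic_has_derivative differentiable_def by blast
  show "gradient (quartic c y p \<alpha> \<beta> C) differentiable at z"
    using gradient_quartic_has_derivative differentiable_def by blast
  show "continuous_on S (hessian (quartic c y p \<alpha> \<beta> C))"
    unfolding hessian_quartic[abs_def] matrix_def
    by (intro continuous_intros)
qed

text \<open>Serves the case of a vanishing gradient: the Hessian of the test function at its centre
  is then \<open>\<beta>\<close> times the identity, and \<open>Min\<close> and \<open>Max\<close>
  are taken over a singleton.\<close>

lemma eigenvalues_scalar_matrix:
  fixes A :: "real^'n^'n"
  assumes "\<And>v. A *v v = \<beta> *\<^sub>R v"
  shows "{l. is_eigenvalue A l} = {\<beta>}"
proof -
  have "is_eigenvalue A l \<longleftrightarrow> l = \<beta>" for l
    unfolding is_eigenvalue_def assms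
    by (metis scaleR_cancel_right axis_eq_0_iff zero_neq_one)
  thus ?thesis by auto
qed

lemma inf_laplacian_quartic:
  "inf_laplacian_plus (quartic c y p \<alpha> \<beta> C) y = \<alpha> * (norm p)\<^sup>2 + \<beta>"
  "inf_laplacian_minus (quartic c y p \<alpha> \<beta> C) y = \<alpha> * (norm p)\<^sup>2 + \<beta>"
proof -
  have g: "gradient (quartic c y p \<alpha> \<beta> C) y = p"
    by (simp add: gradient_quartic)
  have e: "{l. is_eigenvalue (hessian (quartic c y p \<alpha> \<beta> C) y) l} = {\<beta>}" if "p = 0"
    by (rule eigenvalues_scalar_matrix) (simp add: hessian_quartic_at_center that)
  have n: "((hessian (quartic c y p \<alpha> \<beta> C) y *v p) \<bullet> p) / (norm p)\<^sup>2 = \<alpha> * (norm p)\<^sup>2 + \<beta>" if "p \<noteq> 0"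
    using that by (simp add: hessian_quartic_at_center inner_add_left power2_norm_eq_inner field_simps)
  show "inf_laplacian_plus (quartic c y p \<alpha> \<beta> C) y = \<alpha> * (norm p)\<^sup>2 + \<beta>"
       "inf_laplacian_minus (quartic c y p \<alpha> \<beta> C) y = \<alpha> * (norm p)\<^sup>2 + \<beta>"
    using e n by (auto simp: inf_laplacian_plus_def inf_laplacian_minus_def g lambda_max_def lambda_min_def)
qed

section \<open>From viscosity inequalities to second-order jets\<close>

text \<open>
  The test quadratics are only allowed Hessians of the form \<open>\<alpha> p p\<^sup>T + \<beta> I\<close> with gradient \<open>p\<close>, for which both
  infinity Laplacians are \<open>\<alpha> |p|^2 + \<beta>\<close>, also when \<open>p = 0\<close>. Hence super-solutions \<open>u\<close> for the
  right-hand side \<open>k\<close> are covered as well, through \<open>- u\<close> and \<open>\<kappa> = - k\<close>.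
\<close>

definition jet_sub :: "(real^'n) set \<Rightarrow> real \<Rightarrow> (real^'n \<Rightarrow> real) \<Rightarrow> bool" where
  "jet_sub \<Omega> \<kappa> v \<longleftrightarrow> (\<forall>y\<in>\<Omega>. \<forall>p \<alpha> \<beta>.
     (\<forall>\<^sub>F z in nhds y. v z \<le> quartic (v y) y p \<alpha> \<beta> 0 z) \<longrightarrow> - \<kappa> \<le> \<alpha> * (norm p)\<^sup>2 + \<beta>)"

lemma quartic_touches_globally:
  fixes v :: "real^'n \<Rightarrow> real"
  assumes "bounded \<Omega>" "bounded (v ` \<Omega>)" 
    and ev: "\<forall>\<^sub>F z in nhds y. v z \<le> quartic c y p \<alpha> \<beta> 0 z"
  obtains C where "\<And>z. z \<in> \<Omega> \<Longrightarrow> v z \<le> quartic c y p \<alpha> \<beta> C z"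
proof -
  obtain \<epsilon> where \<epsilon>: "\<epsilon> > 0" "\<And>z. dist z y < \<epsilon> \<Longrightarrow> v z \<le> quartic c y p \<alpha> \<beta> 0 z"
    using ev by (auto simp: eventually_nhds_metric)
  obtain B where B: "\<And>z. z \<in> \<Omega> \<Longrightarrow> v z \<le> B"
    using assms(2) by (auto simp: bounded_iff) (meson abs_le_D1)
  have "compact (closure \<Omega>)" using assms(1) by simp
  moreover have "continuous_on (closure \<Omega>) (quartic c y p \<alpha> \<beta> 0)"
    unfolding quartic_def[abs_def] by (intro continuous_intros)
  ultimately have "bounded (quartic c y p \<alpha> \<beta> 0 ` closure \<Omega>)"
    using compact_continuous_image compact_imp_bounded by blast
  then obtain B' where B': "\<And>z. z \<in> closure \<Omega> \<Longrightarrow> \<bar>quartic c y p \<alpha> \<beta> 0 z\<bar> \<le> B'"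
    by (auto simp: bounded_iff)
  \<comment> \<open>Outside the ball of radius \<open>\<epsilon>\<close> the quartic term is at
    least \<open>C\<close> times the fourth power of \<open>\<epsilon>\<close>; this choice makes it
    pay for both the bound \<open>B\<close> on \<open>v\<close> and the bound \<open>B'\<close> on
    the quadratic part.\<close>
  define C where "C = (\<bar>B\<bar> + \<bar>B'\<bar>) / (\<epsilon>\<^sup>2)\<^sup>2"
  have C0: "C \<ge> 0" unfolding C_def by simp
  have "v z \<le> quartic c y p \<alpha> \<beta> C z" if z: "z \<in> \<Omega>" for z
  proof -
    let ?h2 = "(z - y) \<bullet> (z - y)"
    have q: "quartic c y p \<alpha> \<beta> C z = quartic c y p \<alpha> \<beta> 0 z + C * ?h2\<^sup>2"
      by (simp add: quartic_def)
    show ?thesis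
    proof (cases "dist z y < \<epsilon>")
      case True
      have "0 \<le> C * ?h2\<^sup>2" using C0 by simp
      thus ?thesis using \<epsilon>(2)[OF True] q by linarith
    next
      case False
      hence "\<epsilon>\<^sup>2 \<le> ?h2" using \<epsilon>(1)
        by (metis dist_norm linorder_not_less power2_norm_eq_inner power_mono less_imp_le)
      hence "(\<epsilon>\<^sup>2)\<^sup>2 \<le> ?h2\<^sup>2" by (rule power_mono) simp
      hence "C * (\<epsilon>\<^sup>2)\<^sup>2 \<le> C * ?h2\<^sup>2" using C0 mult_left_mono by blast
      moreover have "C * (\<epsilon>\<^sup>2)\<^sup>2 = \<bar>B\<bar> + \<bar>B'\<bar>" using \<epsilon>(1) by (simp add: C_def)
      moreover have "z \<in> closure \<Omega>" using z closure_subset by blast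
      ultimately show ?thesis using q B[OF z] B'[of z] by linarith
    qed
  qed
  thus ?thesis using that by blast
qed

lemma subsolution_jet_sub:
  assumes "bounded \<Omega>" "bounded (u ` \<Omega>)" "viscosity_subsolution \<Omega> (\<lambda>x. k) u"
  shows "jet_sub \<Omega> k u"
  unfolding jet_sub_def
proof (intro ballI allI impI)
  fix y p \<alpha> \<beta> assume y: "y \<in> \<Omega>" and ev: "\<forall>\<^sub>F z in nhds y. u z \<le> quartic (u y) y p \<alpha> \<beta> 0 z"
  obtain C where C: "\<And>z. z \<in> \<Omega> \<Longrightarrow> u z \<le> quartic (u y) y p \<alpha> \<beta> C z"
    using quartic_touches_globally[OF assms(1,2) ev] by blast
  have "touches_from_below \<Omega> u y (quartic (u y) y p \<alpha> \<beta> C)"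
    using C by (auto simp: touches_from_below_def quartic_def)
  hence "- inf_laplacian_plus (quartic (u y) y p \<alpha> \<beta> C) y \<le> k"
    using assms(3) y C2_on_quartic unfolding viscosity_subsolution_def by blast
  thus "- k \<le> \<alpha> * (norm p)\<^sup>2 + \<beta>" by (simp add: inf_laplacian_quartic)
qed

lemma supersolution_jet_sub:
  assumes "bounded \<Omega>" "bounded (u ` \<Omega>)" "viscosity_supersolution \<Omega> (\<lambda>x. k) u"
  shows "jet_sub \<Omega> (- k) (\<lambda>x. - u x)"
  unfolding jet_sub_def
proof (intro ballI allI impI)
  fix y p \<alpha> \<beta> assume y: "y \<in> \<Omega>" and ev: "\<forall>\<^sub>F z in nhds y. - u z \<le> quartic (- u y) y p \<alpha> \<beta> 0 z"
  have "bounded ((\<lambda>x. - u x) ` \<Omega>)"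
    using assms(2) by (auto simp: bounded_iff)
  then obtain C where C: "\<And>z. z \<in> \<Omega> \<Longrightarrow> - u z \<le> quartic (- u y) y p \<alpha> \<beta> C z"
    using quartic_touches_globally[OF assms(1) _ ev] by blast
  \<comment> \<open>The family of test functions is closed under negation, and changing the sign of
    all coefficients also changes the sign of the infinity Laplacian at the centre.\<close>
  have neg: "- quartic (- u y) y p \<alpha> \<beta> C z = quartic (u y) y (- p) (- \<alpha>) (- \<beta>) (- C) z" for z
    by (simp add: quartic_def)
  have "touches_from_below \<Omega> (quartic (u y) y (- p) (- \<alpha>) (- \<beta>) (- C)) y u"
    using C by (auto simp: touches_from_below_def neg[symmetric] minus_le_iff) (simp add: quartic_def)
  hence "- inf_laplacian_minus (quartic (u y) y (- p) (- \<alpha>) (- \<beta>) (- C)) y \<ge> k"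
    using assms(3) y C2_on_quartic unfolding viscosity_supersolution_def by blast
  thus "- (- k) \<le> \<alpha> * (norm p)\<^sup>2 + \<beta>" by (simp add: inf_laplacian_quartic)
qed

section \<open>Suprema over closed balls\<close>

definition ball_sup :: "('a::metric_space \<Rightarrow> real) \<Rightarrow> 'a \<Rightarrow> real \<Rightarrow> real" where
  "ball_sup v x \<rho> = Sup (v ` cball x \<rho>)"

lemma ball_sup_upper:
  fixes x :: "'a::heine_borel"
  assumes "continuous_on (cball x \<rho>) v" "z \<in> cball x \<rho>"
  shows "v z \<le> ball_sup v x \<rho>"
proof -
  have "compact (v ` cball x \<rho>)" by (intro compact_continuous_image assms(1) compact_cball)
  hence "bdd_above (v ` cball x \<rho>)" by (simp add: bounded_imp_bdd_above compact_imp_bounded)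
  thus ?thesis unfolding ball_sup_def by (intro cSup_upper imageI assms(2))
qed

lemma ball_sup_attained:
  fixes x :: "'a::heine_borel"
  assumes "continuous_on (cball x \<rho>) v" "0 \<le> \<rho>"
  obtains z where "z \<in> cball x \<rho>" "v z = ball_sup v x \<rho>"
proof -
  obtain z where z: "z \<in> cball x \<rho>" "\<forall>w\<in>cball x \<rho>. v w \<le> v z"
    using continuous_attains_sup[of "cball x \<rho>" v] assms by auto
  have "ball_sup v x \<rho> = v z" unfolding ball_sup_def
    using z by (intro cSup_eq_maximum) auto
  thus ?thesis using that z by simp
qed

lemma ball_sup_mono:
  fixes x :: "'a::heine_borel"
  assumes "continuous_on (cball x \<sigma>) v" "0 \<le> \<rho>" "\<rho> \<le> \<sigma>"
  shows "ball_sup v x \<rho> \<le> ball_sup v x \<sigma>"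
proof -
  have s: "cball x \<rho> \<subseteq> cball x \<sigma>" using assms(3) by (simp add: subset_cball)
  obtain z where "z \<in> cball x \<rho>" "v z = ball_sup v x \<rho>"
    using ball_sup_attained[OF continuous_on_subset[OF assms(1) s] assms(2)] .
  thus ?thesis using ball_sup_upper[OF assms(1) subsetD[OF s]] by metis
qed

section \<open>Comparison with radial parabolas\<close>

text \<open>With \<open>t = e \<bullet> h\<close> and \<open>q = h \<bullet> h - t^2\<close>, the
  squared length of the part of \<open>h\<close> orthogonal to \<open>e\<close>, the squared norm is
  \<open>(\<sigma> + t)^2 + q\<close>. Both bounds follow by comparing squares; for the upper one
  \<open>\<sigma> + t \<ge> \<sigma>/2\<close> lets the cross term absorb \<open>q\<close>.\<close>

lemma norm_expansion:
  fixes e h :: "'a::real_inner"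
  assumes "\<sigma> > 0" "norm e = 1" "norm h \<le> \<sigma>/2"
  shows "\<sigma> + e \<bullet> h \<le> norm (\<sigma> *\<^sub>R e + h)"
    and "norm (\<sigma> *\<^sub>R e + h) \<le> \<sigma> + e \<bullet> h + (h \<bullet> h - (e \<bullet> h)\<^sup>2) / \<sigma>"
proof -
  have ee: "e \<bullet> e = 1" using assms(2) by (simp add: dot_square_norm)
  have t: "\<bar>e \<bullet> h\<bar> \<le> \<sigma>/2" using Cauchy_Schwarz_ineq2[of e h] assms by simp
  have q: "(e \<bullet> h)\<^sup>2 \<le> h \<bullet> h" using Cauchy_Schwarz_ineq[of e h] ee by simp
  have N: "(norm (\<sigma> *\<^sub>R e + h))\<^sup>2 = (\<sigma> + e \<bullet> h)\<^sup>2 + (h \<bullet> h - (e \<bullet> h)\<^sup>2)"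
    unfolding power2_norm_eq_inner
    by (simp add: inner_add_left inner_add_right ee inner_commute power2_eq_square algebra_simps)
  show "\<sigma> + e \<bullet> h \<le> norm (\<sigma> *\<^sub>R e + h)"
    by (rule power2_le_imp_le) (use N q in auto)
  let ?q = "(h \<bullet> h - (e \<bullet> h)\<^sup>2) / \<sigma>"
  have q0: "?q \<ge> 0" using q assms(1) by simp
  have "\<sigma> * ?q = h \<bullet> h - (e \<bullet> h)\<^sup>2" using assms(1) by simp
  moreover have "(\<sigma> / 2) * ?q \<le> (\<sigma> + e \<bullet> h) * ?q" using t q0 by (intro mult_right_mono) auto
  moreover have "(\<sigma> + e \<bullet> h + ?q)\<^sup>2 = (\<sigma> + e \<bullet> h)\<^sup>2 + 2 * ((\<sigma> + e \<bullet> h) * ?q) + ?q\<^sup>2"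
    by (simp add: power2_sum)
  moreover have "(0::real) \<le> ?q\<^sup>2" by simp
  ultimately have "(norm (\<sigma> *\<^sub>R e + h))\<^sup>2 \<le> (\<sigma> + e \<bullet> h + ?q)\<^sup>2" using N by linarith
  thus "norm (\<sigma> *\<^sub>R e + h) \<le> \<sigma> + e \<bullet> h + ?q"
    by (rule power2_le_imp_le) (use t q0 assms in auto)
qed

text \<open>The excess \<open>d = N - \<sigma> - t\<close> lies between \<open>0\<close> and
  \<open>q/\<sigma>\<close>. Replacing \<open>N - \<sigma>\<close> by \<open>t\<close> therefore
  changes the linear term by at most \<open>\<bar>\<pi>\<bar> * q/\<sigma>\<close> and the square by
  at most \<open>2*q\<close>. The error is purely tangential, and so invisible to the infinity
  Laplacian when the gradient is a nonzero multiple of \<open>e\<close>.\<close>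

lemma parabola_norm_expansion:
  fixes e h :: "'a::real_inner"
  assumes "\<sigma> > 0" "norm e = 1" "norm h \<le> \<sigma>/2"
  defines "N \<equiv> norm (\<sigma> *\<^sub>R e + h)"
  shows "\<pi> * (N - \<sigma>) - \<kappa>/2 * (N - \<sigma>)\<^sup>2 \<le>
    \<pi> * (e \<bullet> h) - \<kappa>/2 * (e \<bullet> h)\<^sup>2 + (\<bar>\<pi>\<bar>/\<sigma> + \<bar>\<kappa>\<bar>) * (h \<bullet> h - (e \<bullet> h)\<^sup>2)"
proof -
  define t where "t = e \<bullet> h"
  define q where "q = h \<bullet> h - t\<^sup>2"
  define d where "d = N - \<sigma> - t"
  have ee: "e \<bullet> e = 1" using assms(2) by (simp add: dot_square_norm)
  have t: "\<bar>t\<bar> \<le> \<sigma>/2" unfolding t_def using Cauchy_Schwarz_ineq2[of e h] assms by simp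
  have q: "0 \<le> q" unfolding q_def t_def using Cauchy_Schwarz_ineq[of e h] ee by simp
  have d: "0 \<le> d" "d \<le> q/\<sigma>"
    using norm_expansion[OF assms(1-3)] by (auto simp: d_def N_def t_def q_def)
  have "h \<bullet> h \<le> (\<sigma>/2)\<^sup>2" using assms(3) norm_ge_zero by (metis power2_norm_eq_inner power_mono)
  hence "q \<le> \<sigma>\<^sup>2/4" unfolding q_def by (simp add: power_divide) (smt (verit) zero_le_power2)
  hence "q/\<sigma> \<le> \<sigma>/4" using assms(1) by (simp add: field_simps power2_eq_square)
  hence d4: "d \<le> \<sigma>/4" using d by linarith
  have "\<bar>(N - \<sigma>)\<^sup>2 - t\<^sup>2\<bar> = d * \<bar>2*t + d\<bar>"
  proof -
    have "(N - \<sigma>)\<^sup>2 - t\<^sup>2 = d * (2*t+d)" by (simp add: d_def power2_eq_square algebra_simps)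
    thus ?thesis using d by (simp add: abs_mult)
  qed
  also have "\<dots> \<le> (q/\<sigma>) * (2*\<sigma>)"
    using d t d4 assms(1) q by (intro mult_mono) auto
  also have "\<dots> = 2*q" using assms(1) by simp
  finally have 1: "\<bar>(N - \<sigma>)\<^sup>2 - t\<^sup>2\<bar> \<le> 2*q" .
  have "- (\<kappa>/2 * ((N - \<sigma>)\<^sup>2 - t\<^sup>2)) \<le> \<bar>\<kappa>\<bar>/2 * \<bar>(N - \<sigma>)\<^sup>2 - t\<^sup>2\<bar>"
    using abs_ge_minus_self[of "\<kappa>/2 * ((N - \<sigma>)\<^sup>2 - t\<^sup>2)"] by (simp only: abs_mult abs_divide abs_numeral)
  also have "\<dots> \<le> \<bar>\<kappa>\<bar>/2 * (2*q)" using 1 by (intro mult_left_mono) auto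
  finally have 2: "- (\<kappa>/2 * (N - \<sigma>)\<^sup>2) \<le> - (\<kappa>/2 * t\<^sup>2) + \<bar>\<kappa>\<bar> * q" by (simp add: algebra_simps)
  have "\<pi> * d \<le> \<bar>\<pi>\<bar> * (q/\<sigma>)" using d by (intro mult_mono) auto
  hence 3: "\<pi> * (N - \<sigma>) \<le> \<pi> * t + \<bar>\<pi>\<bar>/\<sigma> * q" by (simp add: d_def algebra_simps)
  show ?thesis using 2 3 unfolding t_def[symmetric] q_def[symmetric] by (simp add: algebra_simps)
qed

text \<open>Concavity: \<open>b\<close> is a convex combination of \<open>a\<close> and
  \<open>c\<close>, and the parabola exceeds its chord by a nonnegative multiple of
  \<open>\<kappa>\<close>.\<close>

lemma parabola_ge_min:
  fixes a b c :: real
  assumes "0 \<le> \<kappa>" "a \<le> b" "b \<le> c" "a < c" "M \<le> A + B*a - \<kappa>/2*a\<^sup>2" "M \<le> A + B*c - \<kappa>/2*c\<^sup>2"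
  shows "M \<le> A + B*b - \<kappa>/2*b\<^sup>2"
proof -
  have "(c-a) * (A + B*b - \<kappa>/2*b\<^sup>2) = (c-b) * (A + B*a - \<kappa>/2*a\<^sup>2) + (b-a) * (A + B*c - \<kappa>/2*c\<^sup>2)
     + \<kappa>/2 * ((b-a)*(c-b)*(c-a))"
    by (simp add: power2_eq_square field_simps)
  moreover have "0 \<le> \<kappa>/2 * ((b-a)*(c-b)*(c-a))" using assms by simp
  moreover have "(c-b) * M \<le> (c-b) * (A + B*a - \<kappa>/2*a\<^sup>2)" using assms by (intro mult_left_mono) auto
  moreover have "(b-a) * M \<le> (b-a) * (A + B*c - \<kappa>/2*c\<^sup>2)" using assms by (intro mult_left_mono) auto
  ultimately have "(c-a) * M \<le> (c-a) * (A + B*b - \<kappa>/2*b\<^sup>2)" by (simp add: algebra_simps)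
  thus ?thesis using assms(4) by simp
qed

text \<open>At a local maximum a constant is an admissible test function, and its jet would force
  \<open>0 \<le> \<kappa>\<close>.\<close>

lemma jet_sub_no_local_max:
  assumes "jet_sub \<Omega> \<kappa> v" "\<kappa> < 0" "y \<in> \<Omega>"
  shows "\<not> (\<forall>\<^sub>F z in nhds y. v z \<le> v y)"
proof
  assume "\<forall>\<^sub>F z in nhds y. v z \<le> v y"
  hence "\<forall>\<^sub>F z in nhds y. v z \<le> quartic (v y) y 0 0 0 0 z" by (simp add: quartic_def)
  hence "- \<kappa> \<le> 0 * (norm (0::real^'a))\<^sup>2 + 0" using assms unfolding jet_sub_def by blast
  thus False using assms by simp
qed

text \<open>
  If the claim fails, \<open>v\<close> minus the radial parabola has a positive interior maximum on the annulus between
  the radii \<open>\<rho>\<^sub>1\<close> and \<open>\<rho>\<^sub>2\<close>, which contradicts the jet condition. For \<open>\<kappa> > 0\<close> concavity of the parabola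
  keeps its slope positive there; for \<open>\<kappa> < 0\<close> the slope may vanish, and the absence of local
  maxima is used to find a positive value on the annulus.
\<close>

lemma ball_sup_le_parabola:
  fixes v :: "real^'n \<Rightarrow> real"
  assumes jet: "jet_sub \<Omega> \<kappa>\<^sub>0 v" and cont: "continuous_on \<Omega> v" and sub: "cball x \<rho>\<^sub>2 \<subseteq> \<Omega>"
    and rho: "0 \<le> \<rho>\<^sub>1" "\<rho>\<^sub>1 < \<rho>" "\<rho> < \<rho>\<^sub>2"
    and kappa: "\<kappa>\<^sub>0 < \<kappa>" "\<kappa> \<noteq> 0"
    and P1: "ball_sup v x \<rho>\<^sub>1 = A + B*\<rho>\<^sub>1 - \<kappa>/2*\<rho>\<^sub>1\<^sup>2"
    and P2: "ball_sup v x \<rho>\<^sub>2 = A + B*\<rho>\<^sub>2 - \<kappa>/2*\<rho>\<^sub>2\<^sup>2"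
  shows "ball_sup v x \<rho> \<le> A + B*\<rho> - \<kappa>/2*\<rho>\<^sup>2"
proof (rule ccontr)
  define P where "P r = A + B*r - \<kappa>/2*r\<^sup>2" for r
  assume "\<not> ball_sup v x \<rho> \<le> A + B*\<rho> - \<kappa>/2*\<rho>\<^sup>2"
  hence big: "P \<rho> < ball_sup v x \<rho>" by (simp add: P_def)
  have c2: "continuous_on (cball x \<rho>\<^sub>2) v" using cont sub continuous_on_subset by blast
  have cr: "continuous_on (cball x r) v" if "r \<le> \<rho>\<^sub>2" for r
    using c2 by (rule continuous_on_subset) (use that in \<open>simp add: subset_cball\<close>)
  have u1: "v z \<le> P \<rho>\<^sub>1" if "dist x z \<le> \<rho>\<^sub>1" for z
    using ball_sup_upper[OF cr[of \<rho>\<^sub>1], of z] that rho P1 by (simp add: P_def)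
  have u2: "v z \<le> P \<rho>\<^sub>2" if "dist x z \<le> \<rho>\<^sub>2" for z
    using ball_sup_upper[OF c2, of z] that P2 by (simp add: P_def)
  have P12: "P \<rho>\<^sub>1 \<le> P \<rho>\<^sub>2" 
    using ball_sup_mono[OF c2, of \<rho>\<^sub>1] rho P1 P2 by (simp add: P_def)
  obtain zs where zs: "dist x zs \<le> \<rho>" "v zs = ball_sup v x \<rho>"
    using ball_sup_attained[OF cr[of \<rho>]] rho by (auto simp: mem_cball)
  have ann: "\<rho>\<^sub>1 \<le> dist x zs \<and> P (dist x zs) < v zs"
  proof (cases "\<kappa> > 0")
    case True
    have "P \<rho>\<^sub>1 \<le> P \<rho>" using parabola_ge_min[of \<kappa> \<rho>\<^sub>1 \<rho> \<rho>\<^sub>2 "P \<rho>\<^sub>1" A B] True P12 rho by (simp add: P_def)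
    hence 1: "\<rho>\<^sub>1 \<le> dist x zs" using u1[of zs] zs big by linarith
    have 2: "v zs \<le> P \<rho>\<^sub>2" using u2[of zs] zs rho by linarith
    have "P (dist x zs) < v zs"
    proof (rule ccontr)
      assume "\<not> P (dist x zs) < v zs"
      hence "v zs \<le> P \<rho>" using parabola_ge_min[of \<kappa> "dist x zs" \<rho> \<rho>\<^sub>2 "v zs" A B] True 2 rho zs
        by (simp add: P_def)
      thus False using big zs by simp
    qed
    with 1 show ?thesis by simp
  next
    case False
    hence neg: "\<kappa>\<^sub>0 < 0" using kappa by simp
    \<comment> \<open>A maximum point over the ball that is not on the sphere would be a local
      maximum of \<open>v\<close>.\<close>
    have "dist x zs = \<rho>"
    proof (rule ccontr)
      assume "dist x zs \<noteq> \<rho>"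
      hence "zs \<in> ball x \<rho>" using zs by simp
      hence "\<forall>\<^sub>F z in nhds zs. z \<in> ball x \<rho>" using eventually_nhds_in_open open_ball by blast
      hence "\<forall>\<^sub>F z in nhds zs. v z \<le> v zs"
        by eventually_elim (use ball_sup_upper[OF cr[of \<rho>]] zs rho in auto)
      moreover have "zs \<in> \<Omega>" using zs rho sub by (auto simp: subset_iff)
      ultimately show False using jet_sub_no_local_max[OF jet neg] by blast
    qed
    thus ?thesis using big zs rho by simp
  qed
  let ?A = "cball x \<rho>\<^sub>2 \<inter> {z. \<rho>\<^sub>1 \<le> dist x z}"
  have "closed {z. \<rho>\<^sub>1 \<le> dist x z}" by (intro closed_Collect_le continuous_intros)
  hence "compact ?A" by (simp add: compact_Int_closed)
  moreover have zsA: "zs \<in> ?A" using ann zs rho by simp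
  moreover have "continuous_on ?A (\<lambda>z. v z - P (dist x z))"
    unfolding P_def by (intro continuous_intros continuous_on_subset[OF c2]) auto
  ultimately obtain y where y: "y \<in> ?A" and ymax: "\<And>z. z \<in> ?A \<Longrightarrow> v z - P (dist x z) \<le> v y - P (dist x y)"
    using continuous_attains_sup[of ?A "\<lambda>z. v z - P (dist x z)"] by blast
  define \<sigma> where "\<sigma> = dist x y"
  have pos: "P \<sigma> < v y" using ymax[OF zsA] ann by (simp add: \<sigma>_def)
  \<comment> \<open>On the two boundary spheres of the annulus \<open>v\<close> does not exceed
    \<open>P\<close>, so a point with positive difference is strictly between them.\<close>
  have s1: "\<rho>\<^sub>1 < \<sigma>" using y u1[of y] pos by (cases "\<sigma> = \<rho>\<^sub>1") (auto simp: \<sigma>_def)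
  have s2: "\<sigma> < \<rho>\<^sub>2" using y u2[of y] pos by (cases "\<sigma> = \<rho>\<^sub>2") (auto simp: \<sigma>_def)
  have s0: "\<sigma> > 0" using s1 rho by simp
  define e where "e = (1/\<sigma>) *\<^sub>R (y - x)"
  have e: "norm e = 1" "\<sigma> *\<^sub>R e = y - x" using s0 by (auto simp: e_def \<sigma>_def dist_norm norm_minus_commute)
  \<comment> \<open>The slope of \<open>P\<close> at the radius \<open>\<sigma>\<close>.\<close>
  define d where "d = B - \<kappa>*\<sigma>"
  have yO: "y \<in> \<Omega>" using y sub by auto
  have "open (ball y (\<sigma>/2) \<inter> ({z. \<rho>\<^sub>1 < dist x z} \<inter> {z. dist x z < \<rho>\<^sub>2}))"
    by (intro open_Int open_ball open_Collect_less continuous_intros)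
  hence "\<forall>\<^sub>F z in nhds y. z \<in> ball y (\<sigma>/2) \<inter> ({z. \<rho>\<^sub>1 < dist x z} \<inter> {z. dist x z < \<rho>\<^sub>2})"
    by (rule eventually_nhds_in_open) (use s0 s1 s2 in \<open>auto simp: \<sigma>_def\<close>)
  hence near: "\<forall>\<^sub>F z in nhds y. norm (z - y) \<le> \<sigma>/2 \<and>
      v z \<le> v y + (d * (norm (\<sigma> *\<^sub>R e + (z - y)) - \<sigma>) - \<kappa>/2 * (norm (\<sigma> *\<^sub>R e + (z - y)) - \<sigma>)\<^sup>2)"
  proof eventually_elim
    case (elim z)
    have n: "norm (\<sigma> *\<^sub>R e + (z - y)) = dist x z" by (simp add: e dist_norm norm_minus_commute)
    have "v z \<le> v y + (P (dist x z) - P \<sigma>)" using ymax[of z] elim by (simp add: \<sigma>_def)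
    also have "P (dist x z) - P \<sigma> = d * (dist x z - \<sigma>) - \<kappa>/2 * (dist x z - \<sigma>)\<^sup>2"
      by (simp add: P_def d_def power2_eq_square algebra_simps)
    finally show ?case using n elim by (simp add: dist_norm norm_minus_commute)
  qed
  show False
  proof (cases "d = 0")
    case False
    \<comment> \<open>\<open>K\<close> bounds the tangential error. The Hessian \<open>2*K\<close>
      times the identity plus \<open>(-\<kappa> - 2*K)\<close> times the projection onto
      \<open>e\<close> has value \<open>-\<kappa>\<close> in the direction of the gradient
      \<open>d *\<^sub>R e\<close>, so \<open>K\<close> cancels; dividing by \<open>d^2\<close>
      compensates for the length of the gradient.\<close>
    define K where "K = \<bar>d\<bar>/\<sigma> + \<bar>\<kappa>\<bar>"
    have "\<forall>\<^sub>F z in nhds y. v z \<le> quartic (v y) y (d *\<^sub>R e) ((-\<kappa> - 2*K)/d\<^sup>2) (2*K) 0 z"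
      using near
    proof eventually_elim
      case (elim z)
      have eq: "(-\<kappa> - 2*K)/d\<^sup>2/2 * (d * (e \<bullet> (z-y)))\<^sup>2 = (-\<kappa>/2 - K) * (e \<bullet> (z-y))\<^sup>2"
        using False by (simp add: power_mult_distrib field_simps)
      have "v z \<le> v y + (d * (e \<bullet> (z-y)) - \<kappa>/2 * (e \<bullet> (z-y))\<^sup>2
          + K * ((z-y) \<bullet> (z-y) - (e \<bullet> (z-y))\<^sup>2))"
        using parabola_norm_expansion[OF s0 e(1), of "z-y" d \<kappa>] elim unfolding K_def by linarith
      also have "\<dots> = quartic (v y) y (d *\<^sub>R e) ((-\<kappa> - 2*K)/d\<^sup>2) (2*K) 0 z"
        unfolding quartic_def inner_scaleR_left eq by (simp add: algebra_simps)
      finally show ?case .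
    qed
    hence "- \<kappa>\<^sub>0 \<le> (-\<kappa> - 2*K)/d\<^sup>2 * (norm (d *\<^sub>R e))\<^sup>2 + 2*K"
      using jet yO unfolding jet_sub_def by blast
    also have "\<dots> = -\<kappa>" using False e by (simp add: power_mult_distrib)
    finally show False using kappa by simp
  next
    case True
    \<comment> \<open>A concave parabola with slope zero at \<open>\<sigma>\<close> cannot rise
      afterwards, but \<open>P \<sigma> < v y \<le> P \<rho>\<^sub>2\<close>.\<close>
    have "\<not> \<kappa> > 0"
    proof
      assume k: "\<kappa> > 0"
      have "P \<sigma> < P \<rho>\<^sub>2" using u2[of y] pos s2 by (simp add: \<sigma>_def)
      hence "0 < (\<rho>\<^sub>2 - \<sigma>) * (B - \<kappa>/2 * (\<sigma> + \<rho>\<^sub>2))" by (simp add: P_def power2_eq_square algebra_simps diff_divide_distrib)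
      hence "0 < B - \<kappa>/2 * (\<sigma> + \<rho>\<^sub>2)" using s2 by (simp add: zero_less_mult_iff)
      moreover have "\<kappa>/2 * (\<sigma> + \<sigma>) \<le> \<kappa>/2 * (\<sigma> + \<rho>\<^sub>2)" using k s2 by (intro mult_left_mono) auto
      ultimately show False using True by (simp add: d_def)
    qed
    hence k: "\<kappa> < 0" using kappa by simp
    have "\<forall>\<^sub>F z in nhds y. v z \<le> quartic (v y) y 0 0 (-\<kappa>) 0 z"
      using near
    proof eventually_elim
      case (elim z)
      \<comment> \<open>At zero slope only the square of the radial increment remains; it is at most
        the full squared distance, so an isotropic quadratic touches from above.\<close>
      have "\<bar>norm (\<sigma> *\<^sub>R e + (z - y)) - \<sigma>\<bar> \<le> norm (z - y)"
        using norm_triangle_ineq3[of "\<sigma> *\<^sub>R e + (z - y)" "\<sigma> *\<^sub>R e"] e(1) s0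
        by simp
      hence "(norm (\<sigma> *\<^sub>R e + (z - y)) - \<sigma>)\<^sup>2 \<le> (z-y) \<bullet> (z-y)"
        by (metis abs_le_square_iff abs_norm_cancel power2_norm_eq_inner)
      hence "- \<kappa>/2 * (norm (\<sigma> *\<^sub>R e + (z - y)) - \<sigma>)\<^sup>2 \<le> - \<kappa>/2 * ((z-y) \<bullet> (z-y))"
        using k by (intro mult_left_mono) auto
      thus ?case using elim True by (simp add: quartic_def)
    qed
    hence "- \<kappa>\<^sub>0 \<le> 0 * (norm (0::real^'n))\<^sup>2 + (-\<kappa>)" using jet yO unfolding jet_sub_def by blast
    thus False using kappa by simp
  qed
qed

section \<open>Semiconvexity in the radius\<close>

text \<open>Each chord inequality is the comparison with an interpolating parabola whose coefficient
  \<open>k\<close> is slightly larger than \<open>\<kappa>\<close>, followed by the limit of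
  \<open>k\<close> to \<open>\<kappa>\<close> from the right. Values \<open>k\<close> near
  \<open>\<kappa>\<close> other than \<open>0\<close> suffice for that limit.\<close>

lemma ball_sup_semiconvex:
  fixes v :: "real^'n \<Rightarrow> real"
  assumes jet: "jet_sub \<Omega> \<kappa> v" and cont: "continuous_on \<Omega> v" and sub: "cball x R \<subseteq> \<Omega>"
  shows "convex_on {0..R} (\<lambda>\<rho>. ball_sup v x \<rho> + \<kappa>/2 * \<rho>\<^sup>2)"
proof (rule convex_on_linorderI)
  fix t \<rho>\<^sub>1 \<rho>\<^sub>2 :: real
  assume t: "0 < t" "t < 1" and r: "\<rho>\<^sub>1 \<in> {0..R}" "\<rho>\<^sub>2 \<in> {0..R}" "\<rho>\<^sub>1 < \<rho>\<^sub>2"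
  define \<rho> where "\<rho> = (1 - t) * \<rho>\<^sub>1 + t * \<rho>\<^sub>2"
  define D where "D = \<rho>\<^sub>2 - \<rho>\<^sub>1"
  have D: "D > 0" "\<rho>\<^sub>2 = \<rho>\<^sub>1 + D" "\<rho> = \<rho>\<^sub>1 + t * D" using r by (auto simp: D_def \<rho>_def algebra_simps)
  have rr: "\<rho>\<^sub>1 < \<rho>" "\<rho> < \<rho>\<^sub>2" using t D by (auto)
  let ?g = "ball_sup v x"
  have bound: "?g \<rho> \<le> (1-t) * ?g \<rho>\<^sub>1 + t * ?g \<rho>\<^sub>2 + k/2 * (t*(1-t)*D\<^sup>2)" if k: "\<kappa> < k" "k \<noteq> 0" for k
  proof -
    \<comment> \<open>\<open>A\<close> and \<open>B\<close> are determined by interpolation at the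
      two end radii.\<close>
    define B where "B = (?g \<rho>\<^sub>2 - ?g \<rho>\<^sub>1)/D + k/2*(\<rho>\<^sub>1+\<rho>\<^sub>2)"
    define A where "A = ?g \<rho>\<^sub>1 - B*\<rho>\<^sub>1 + k/2*\<rho>\<^sub>1\<^sup>2"
    have BD: "B * D = ?g \<rho>\<^sub>2 - ?g \<rho>\<^sub>1 + k/2*(\<rho>\<^sub>1+\<rho>\<^sub>2)*D" using D(1) by (simp add: B_def field_simps)
    have "?g \<rho> \<le> A + B*\<rho> - k/2*\<rho>\<^sup>2"
    proof (rule ball_sup_le_parabola[OF jet cont _ _ rr k])
      show "cball x \<rho>\<^sub>2 \<subseteq> \<Omega>" using sub r by (meson atLeastAtMost_iff order_trans subset_cball)
      show "0 \<le> \<rho>\<^sub>1" using r by simp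
      show "?g \<rho>\<^sub>1 = A + B*\<rho>\<^sub>1 - k/2*\<rho>\<^sub>1\<^sup>2" by (simp add: A_def)
      have "A + B*\<rho>\<^sub>2 - k/2*\<rho>\<^sub>2\<^sup>2 = ?g \<rho>\<^sub>1 + B * D - k/2*(\<rho>\<^sub>1+\<rho>\<^sub>2)*D"
        by (simp add: A_def D(2) power2_eq_square algebra_simps)
      thus "?g \<rho>\<^sub>2 = A + B*\<rho>\<^sub>2 - k/2*\<rho>\<^sub>2\<^sup>2" using BD by simp
    qed
    also have "A + B*\<rho> - k/2*\<rho>\<^sup>2 = ?g \<rho>\<^sub>1 + t * (B * D) - k/2 * (t*D*(2*\<rho>\<^sub>1 + t*D))"
      by (simp add: A_def D(3) power2_eq_square algebra_simps)
    also have "\<dots> = (1-t) * ?g \<rho>\<^sub>1 + t * ?g \<rho>\<^sub>2 + k/2 * (t*(1-t)*D\<^sup>2)"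
      unfolding BD by (simp add: D(2) power2_eq_square field_simps)
    finally show ?thesis .
  qed
  let ?R = "\<lambda>k. (1-t) * ?g \<rho>\<^sub>1 + t * ?g \<rho>\<^sub>2 + k/2 * (t*(1-t)*D\<^sup>2)"
  have "(?R \<longlongrightarrow> ?R \<kappa>) (at_right \<kappa>)" by (intro tendsto_intros) auto
  moreover have "\<forall>\<^sub>F k in at_right \<kappa>. ?g \<rho> \<le> ?R k"
  proof -
    have "\<forall>\<^sub>F k in at_right \<kappa>. k \<noteq> 0"
      by (cases "\<kappa> < 0") (auto simp: eventually_at_right_field intro: exI[of _ 0] exI[of _ "\<kappa>+1"])
    moreover have "\<forall>\<^sub>F k in at_right \<kappa>. \<kappa> < k" by (simp add: eventually_at_right_less)
    ultimately show ?thesis by eventually_elim (rule bound)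
  qed
  ultimately have "?g \<rho> \<le> ?R \<kappa>" using tendsto_lowerbound trivial_limit_at_right_real by blast
  moreover have "\<kappa>/2 * (t*(1-t)*D\<^sup>2) + \<kappa>/2 * \<rho>\<^sup>2 = (1-t) * (\<kappa>/2 * \<rho>\<^sub>1\<^sup>2) + t * (\<kappa>/2 * \<rho>\<^sub>2\<^sup>2)"
    by (simp add: D(2,3) power2_eq_square field_simps)
  ultimately show "?g ((1 - t) *\<^sub>R \<rho>\<^sub>1 + t *\<^sub>R \<rho>\<^sub>2) + \<kappa>/2 * ((1 - t) *\<^sub>R \<rho>\<^sub>1 + t *\<^sub>R \<rho>\<^sub>2)\<^sup>2
     \<le> (1-t) * (?g \<rho>\<^sub>1 + \<kappa>/2 * \<rho>\<^sub>1\<^sup>2) + t * (?g \<rho>\<^sub>2 + \<kappa>/2 * \<rho>\<^sub>2\<^sup>2)"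
    unfolding real_scaleR_def \<rho>_def[symmetric] by (simp add: algebra_simps)
qed simp

text \<open>A supporting line of the convex function at the interior radius \<open>r\<close> becomes
  a supporting parabola once the term \<open>\<kappa>/2 * \<rho>^2\<close> is moved to the other
  side; this also shifts the slope by \<open>\<kappa> * r\<close>.\<close>

lemma ball_sup_subgradient:
  fixes v :: "real^'n \<Rightarrow> real"
  assumes "jet_sub \<Omega> \<kappa> v" "continuous_on \<Omega> v" "cball x R \<subseteq> \<Omega>" "0 < r" "r < R"
  obtains p where "\<And>s. 0 \<le> r + s \<Longrightarrow> r + s \<le> R \<Longrightarrow>
     ball_sup v x r + p * s - \<kappa>/2 * s\<^sup>2 \<le> ball_sup v x (r + s)"
proof -
  define k where "k = (\<lambda>\<rho>. ball_sup v x \<rho> + \<kappa>/2 * \<rho>\<^sup>2)"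
  have c: "convex_on {0..R} k" unfolding k_def by (rule ball_sup_semiconvex[OF assms(1-3)])
  define l where "l = Inf ((\<lambda>t. (k r - k t) / (r - t)) ` ({r<..} \<inter> {0..R}))"
  have "r \<in> interior {0..R}" using assms by (simp add: interior_atLeastAtMost_real)
  hence *: "k r + l * (q - r) \<le> k q" if "q \<in> {0..R}" for q
    using convex_le_Inf_differential[OF c] that unfolding l_def by blast
  have "ball_sup v x r + (l - \<kappa>*r) * s - \<kappa>/2 * s\<^sup>2 \<le> ball_sup v x (r + s)" if "0 \<le> r + s" "r + s \<le> R" for s
    using *[of "r+s"] that by (simp add: k_def power2_eq_square algebra_simps add_divide_distrib)
  thus ?thesis using that by blast
qed

section \<open>Square roots of supporting parabolas\<close>

text \<open>The first-order condition at \<open>s = 0\<close>. The factor \<open>l\<close> stays on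
  both sides, since for \<open>l = 0\<close> the inequality carries no information about
  \<open>p\<close>.\<close>

lemma sqrt_parabola_stationary:
  fixes a c :: real
  assumes "a > 0" "c > 0" "\<eta> > 0"
    and max: "\<And>s. \<bar>s\<bar> < \<eta> \<Longrightarrow>
      l * sqrt (a\<^sup>2 + p * s - s\<^sup>2/2) - sqrt (c\<^sup>2 + q * (l * s) - (l * s)\<^sup>2/2) \<le> l * a - c"
  shows "l * (p / a) = l * (q / c)"
proof -
  let ?f = "\<lambda>s. l * sqrt (a\<^sup>2 + p * s - s\<^sup>2/2) - sqrt (c\<^sup>2 + q * (l * s) - (l * s)\<^sup>2/2)"
  have "(?f has_real_derivative (l * (p / (2 * a)) - q * l / (2 * c))) (at 0)"
    using assms(1,2) by (auto intro!: derivative_eq_intros simp: field_simps)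
  moreover have "\<forall>s. \<bar>0 - s\<bar> < \<eta> \<longrightarrow> ?f s \<le> ?f 0" using max assms(1,2) by simp
  ultimately have "l * (p / (2 * a)) - q * l / (2 * c) = 0"
    using DERIV_local_max assms(3) by blast
  thus ?thesis using assms(1,2) by (simp add: field_simps)
qed

text \<open>Varying one of the two parameters alone gives the first-order conditions. They turn the
  three roots, along \<open>s\<^sub>1 = a * s\<close> and \<open>s\<^sub>2 = b * s\<close>, into
  multiples of one function \<open>\<theta>\<close>, so the expression becomes
  \<open>q * \<theta> s - c * \<theta> (k * s)\<close> with \<open>k = q / c\<close>. If
  \<open>k > 1\<close>, its first derivative at \<open>0\<close> vanishes and its second is positive
  because \<open>\<theta>\<close> is strictly concave, which is impossible at a maximum. The proof
  checks this algebraically at one small \<open>s > 0\<close>.\<close>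

lemma weighted_sqrt_parabola_max:
  fixes a b c :: real
  assumes pos: "a > 0" "b > 0" "c > 0" "l \<ge> 0" "m \<ge> 0" "\<eta> > 0"
    and max: "\<And>s\<^sub>1 s\<^sub>2. \<bar>s\<^sub>1\<bar> < \<eta> \<Longrightarrow> \<bar>s\<^sub>2\<bar> < \<eta> \<Longrightarrow> (0 \<le> s\<^sub>1 \<and> 0 \<le> s\<^sub>2) \<or> (s\<^sub>1 \<le> 0 \<and> s\<^sub>2 \<le> 0) \<Longrightarrow>
      l * sqrt (a\<^sup>2 + p\<^sub>1 * s\<^sub>1 - s\<^sub>1\<^sup>2/2) + m * sqrt (b\<^sup>2 + p\<^sub>2 * s\<^sub>2 - s\<^sub>2\<^sup>2/2)
      - sqrt (c\<^sup>2 + p * (l * s\<^sub>1 + m * s\<^sub>2) - (l * s\<^sub>1 + m * s\<^sub>2)\<^sup>2/2) \<le> l * a + m * b - c"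
  shows "l * a + m * b \<le> c"
proof (rule ccontr)
  define q where "q = l * a + m * b"
  define k where "k = q / c"
  define P where "P = p / (2 * c)"
  assume "\<not> l * a + m * b \<le> c"
  hence qc: "c < q" by (simp add: q_def)
  have e1: "l * (p\<^sub>1 / a) = l * (p / c)"
    by (rule sqrt_parabola_stationary[OF pos(1,3,6)]) (use max[of _ 0] pos in force)
  have e2: "m * (p\<^sub>2 / b) = m * (p / c)"
    by (rule sqrt_parabola_stationary[OF pos(2,3,6)]) (use max[of 0] pos in force)
  define \<theta> where "\<theta> s = sqrt (1 + 2 * P * s - s\<^sup>2/2)" for s
  have "((\<lambda>s. 1 + 2 * P * s - s\<^sup>2/2) \<longlongrightarrow> 1 + 2 * P * 0 - 0\<^sup>2/2) (at_right 0)"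
    by (intro tendsto_intros) auto
  hence "\<forall>\<^sub>F s in at_right 0. 0 < 1 + 2 * P * s - s\<^sup>2/2"
    by (rule order_tendstoD(1)) simp
  moreover have "((\<lambda>s. 1 + 2 * P * (k * s) - (k * s)\<^sup>2/2) \<longlongrightarrow> 1 + 2 * P * (k*0) - (k*0)\<^sup>2/2) (at_right 0)"
    by (intro tendsto_intros) auto
  hence "\<forall>\<^sub>F s in at_right 0. 0 < 1 + 2 * P * (k * s) - (k * s)\<^sup>2/2"
    by (rule order_tendstoD(1)) simp
  moreover have "((\<lambda>s. a * s) \<longlongrightarrow> a * 0) (at_right 0)" "((\<lambda>s. b * s) \<longlongrightarrow> b * 0) (at_right 0)"
    by (intro tendsto_intros; auto)+
  hence "\<forall>\<^sub>F s in at_right 0. a * s < \<eta>" "\<forall>\<^sub>F s in at_right 0. b * s < \<eta>"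
    using order_tendstoD(2) pos(6) by fastforce+
  moreover have "\<forall>\<^sub>F s in at_right 0. 0 < (s::real)" by (simp add: eventually_at_right_less)
  ultimately have "\<forall>\<^sub>F s in at_right 0. 0 < s \<and> a * s < \<eta> \<and> b * s < \<eta>
      \<and> 0 < 1 + 2 * P * s - s\<^sup>2/2 \<and> 0 < 1 + 2 * P * (k * s) - (k * s)\<^sup>2/2"
    by eventually_elim auto
  then obtain s where s: "0 < s" "a * s < \<eta>" "b * s < \<eta>"
      "0 < 1 + 2 * P * s - s\<^sup>2/2" "0 < 1 + 2 * P * (k * s) - (k * s)\<^sup>2/2"
    using eventually_happens'[OF trivial_limit_at_right_real] by blast
  have scale: "sqrt (d\<^sup>2 + (2 * P * d) * (d * t) - (d * t)\<^sup>2/2) = d * \<theta> t" if "d > 0" for d t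
  proof -
    have "d\<^sup>2 + (2 * P * d) * (d * t) - (d * t)\<^sup>2/2 = d\<^sup>2 * (1 + 2 * P * t - t\<^sup>2/2)"
      by (simp add: power2_eq_square algebra_simps)
    thus ?thesis using that by (simp add: real_sqrt_mult \<theta>_def)
  qed
  \<comment> \<open>The slope \<open>p\<^sub>1\<close> is known only for
    \<open>l \<noteq> 0\<close>; otherwise both sides vanish.\<close>
  have t1: "l * sqrt (a\<^sup>2 + p\<^sub>1 * (a * s) - (a * s)\<^sup>2/2) = l * (a * \<theta> s)"
  proof (cases "l = 0")
    case False
    hence "p\<^sub>1 = 2 * P * a" using e1 pos by (simp add: P_def field_simps)
    thus ?thesis using scale[OF pos(1)] by simp
  qed simp
  have t2: "m * sqrt (b\<^sup>2 + p\<^sub>2 * (b * s) - (b * s)\<^sup>2/2) = m * (b * \<theta> s)"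
  proof (cases "m = 0")
    case False
    hence "p\<^sub>2 = 2 * P * b" using e2 pos by (simp add: P_def field_simps)
    thus ?thesis using scale[OF pos(2)] by simp
  qed simp
  have ck: "l * (a * s) + m * (b * s) = c * (k * s)" "p = 2 * P * c"
    using pos by (simp_all add: k_def q_def P_def field_simps)
  have "l * (a * \<theta> s) + m * (b * \<theta> s) - c * \<theta> (k * s) \<le> q - c"
    using max[of "a * s" "b * s"] s pos unfolding t1 t2 ck scale[OF pos(3)] q_def by simp
  hence "q * \<theta> s - c * \<theta> (k * s) \<le> q - c" by (simp add: q_def algebra_simps)
  hence "(q * \<theta> s - c * \<theta> (k * s)) / c \<le> (q - c) / c" using pos(3) by (intro divide_right_mono) auto
  hence ineq: "k * \<theta> s \<le> \<theta> (k * s) + (k - 1)" using pos(3) by (simp add: k_def diff_divide_distrib)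
  have k1: "k > 1" using qc pos by (simp add: k_def)
  have X: "(\<theta> s)\<^sup>2 = 1 + 2 * P * s - s\<^sup>2/2" and Y: "(\<theta> (k * s))\<^sup>2 = 1 + 2 * P * (k * s) - (k * s)\<^sup>2/2"
    using s(4,5) by (simp_all add: \<theta>_def)
  have X0: "\<theta> s > 0" using s(4) by (simp add: \<theta>_def)
  have "(k * \<theta> s)\<^sup>2 \<le> (\<theta> (k * s) + (k-1))\<^sup>2" using ineq X0 k1 by (intro power_mono) auto
  \<comment> \<open>Quantitative convexity of the square: \<open>\<theta> (k * s) + (k - 1)\<close>
    is \<open>k\<close> times the average of \<open>\<theta> (k * s)\<close> and \<open>1\<close>
    with weights \<open>1/k\<close> and \<open>(k - 1)/k\<close>.\<close>
  also have "\<dots> = k * ((\<theta> (k * s))\<^sup>2 + (k-1)) - (k-1) * (\<theta> (k * s) - 1)\<^sup>2"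
    by (simp add: power2_eq_square algebra_simps)
  also have "\<dots> \<le> k * ((\<theta> (k * s))\<^sup>2 + (k-1))" using k1 by simp
  finally have "k * (k * (\<theta> s)\<^sup>2) \<le> k * ((\<theta> (k * s))\<^sup>2 + (k-1))"
    by (simp add: power2_eq_square ac_simps)
  hence "k * (\<theta> s)\<^sup>2 \<le> (\<theta> (k * s))\<^sup>2 + (k-1)" using k1 by simp
  hence "k * (k - 1) * s\<^sup>2 \<le> 0" unfolding X Y by (simp add: power2_eq_square algebra_simps diff_divide_distrib)
  moreover have "0 < k * (k - 1) * s\<^sup>2" using k1 s(1) by simp
  ultimately show False by simp
qed

section \<open>Changing radii by moving centres\<close>

text \<open>The centre moves towards \<open>z\<close> by the fraction \<open>s/(r+s)\<close> of the
  way, which leaves at most the distance \<open>r\<close>.\<close>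

lemma cball_add_split:
  fixes x :: "'a::real_normed_vector"
  assumes "0 < r" "0 \<le> s" "z \<in> cball x (r + s)"
  obtains d where "norm d \<le> 1" "z \<in> cball (x + s *\<^sub>R d) r"
proof
  let ?d = "(1/(r+s)) *\<^sub>R (z - x)"
  have n: "norm (z - x) \<le> r + s" using assms(3) by (simp add: dist_norm norm_minus_commute)
  show "norm ?d \<le> 1" unfolding norm_scaleR using n assms by (simp add: field_simps)
  have "z - (x + s *\<^sub>R ?d) = (1 - s/(r+s)) *\<^sub>R (z - x)"
    by (simp add: algebra_simps)
  also have "1 - s/(r+s) = r/(r+s)" using assms by (simp add: field_simps)
  finally have "z - (x + s *\<^sub>R ?d) = (r/(r+s)) *\<^sub>R (z - x)" .
  hence "norm (z - (x + s *\<^sub>R ?d)) = r/(r+s) * norm (z - x)" using assms by simp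
  also have "\<dots> \<le> r/(r+s) * (r+s)" using n assms by (intro mult_left_mono) auto
  finally show "z \<in> cball (x + s *\<^sub>R ?d) r" using assms by (simp add: dist_norm norm_minus_commute)
qed

text \<open>Counterpart for shrunk balls: the displacement may have any direction.\<close>

lemma cball_shift_mem:
  fixes x :: "'a::real_normed_vector"
  assumes "z \<in> cball x (r - s)" "norm d \<le> s"
  shows "z \<in> cball (x + d) r"
  using assms norm_triangle_ineq4[of "z - x" d]
  by (simp add: dist_norm norm_minus_commute[of _ z] algebra_simps)

text \<open>Maximality is stated for single points instead of suprema over balls, the form in which
  compactness provides it. Changes of the radii are traded for displacements of the centres, and the
  supporting parabolas in the radius then reduce the claim to
  \<open>weighted_sqrt_parabola_max\<close>.\<close>

lemma sqrt_concavity_local_max: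
  fixes u :: "real^'n \<Rightarrow> real"
  assumes sub: "jet_sub \<Omega> 1 u" and super: "jet_sub \<Omega> (-1) (\<lambda>z. - u z)"
    and cont: "continuous_on \<Omega> u" and upos: "\<And>z. z \<in> \<Omega> \<Longrightarrow> 0 < u z"
    and lm: "0 \<le> l" "0 \<le> m" "l + m \<le> 1" and r: "0 < r" "r < R"
    and balls: "cball x R \<subseteq> \<Omega>" "cball y R \<subseteq> \<Omega>" "cball (l *\<^sub>R x + m *\<^sub>R y + n) R \<subseteq> \<Omega>"
    and pts: "x\<^sub>1 \<in> cball x r" "y\<^sub>1 \<in> cball y r" "z\<^sub>1 \<in> cball (l *\<^sub>R x + m *\<^sub>R y + n) r"
    and max: "\<And>x y x' y' z'. x \<in> \<Omega> \<Longrightarrow> y \<in> \<Omega> \<Longrightarrow> x' \<in> \<Omega> \<Longrightarrow> y' \<in> \<Omega> \<Longrightarrow> z' \<in> \<Omega> \<Longrightarrow>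
       x' \<in> cball x r \<Longrightarrow> y' \<in> cball y r \<Longrightarrow> z' \<in> cball (l *\<^sub>R x + m *\<^sub>R y + n) r \<Longrightarrow>
       l * sqrt (u x') + m * sqrt (u y') - sqrt (u z') \<le> l * sqrt (u x\<^sub>1) + m * sqrt (u y\<^sub>1) - sqrt (u z\<^sub>1)"
  shows "l * sqrt (u x\<^sub>1) + m * sqrt (u y\<^sub>1) \<le> sqrt (u z\<^sub>1)"
proof -
  define z where "z = l *\<^sub>R x + m *\<^sub>R y + n"
  define G where "G = ball_sup u"
  define H where "H x \<rho> = - ball_sup (\<lambda>z. - u z) x \<rho>" for x \<rho>
  have contn: "continuous_on \<Omega> (\<lambda>z. - u z)" using cont by (intro continuous_intros)
  have incl: "cball w \<rho> \<subseteq> \<Omega>" if "w \<in> {x,y,z}" "\<rho> \<le> R" for w \<rho>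
  proof -
    have "cball w \<rho> \<subseteq> cball w R" using that(2) by (simp add: subset_cball)
    thus ?thesis using balls that(1) unfolding z_def by blast
  qed
  have Gatt: "\<exists>w'\<in>cball w \<rho>. u w' = G w \<rho>" if "w \<in> {x,y,z}" "0 \<le> \<rho>" "\<rho> \<le> R" for w \<rho>
    using ball_sup_attained[OF continuous_on_subset[OF cont incl] that(2)] that unfolding G_def by metis
  have Hatt: "\<exists>w'\<in>cball w \<rho>. u w' = H w \<rho>" if "w \<in> {x,y,z}" "0 \<le> \<rho>" "\<rho> \<le> R" for w \<rho>
    using ball_sup_attained[OF continuous_on_subset[OF contn incl] that(2)] that unfolding H_def
    by (metis minus_equation_iff)
  have Gup: "u w' \<le> G w r" if "w \<in> {x,y,z}" "w' \<in> cball w r" for w w'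
    using ball_sup_upper[OF continuous_on_subset[OF cont incl], of w r] that r unfolding G_def by auto
  have Hlo: "H w r \<le> u w'" if "w \<in> {x,y,z}" "w' \<in> cball w r" for w w'
    using ball_sup_upper[OF continuous_on_subset[OF contn incl], of w r w'] that r unfolding H_def by auto
  define a where "a = sqrt (G x r)"
  define b where "b = sqrt (G y r)"
  define c where "c = sqrt (H z r)"
  have Gpos: "0 < G x r" "0 < G y r" "0 < H z r"
    using Gatt[of x r] Gatt[of y r] Hatt[of z r] upos incl r by (auto simp del: mem_cball) (metis insertCI less_imp_le subsetD)+
  have abc: "a\<^sup>2 = G x r" "b\<^sup>2 = G y r" "c\<^sup>2 = H z r" "a > 0" "b > 0" "c > 0"
    using Gpos by (auto simp: a_def b_def c_def)
  have M: "l * sqrt (u x\<^sub>1) + m * sqrt (u y\<^sub>1) - sqrt (u z\<^sub>1) \<le> l * a + m * b - c"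
    unfolding a_def b_def c_def
    by (intro diff_mono add_mono mult_left_mono real_sqrt_le_mono Gup Hlo lm) (use pts in \<open>auto simp: z_def\<close>)
  obtain p\<^sub>1 where p1: "\<And>s. 0 \<le> r + s \<Longrightarrow> r + s \<le> R \<Longrightarrow> a\<^sup>2 + p\<^sub>1 * s - s\<^sup>2/2 \<le> G x (r + s)"
    using ball_sup_subgradient[OF sub cont balls(1) r] unfolding abc G_def by auto
  obtain p\<^sub>2 where p2: "\<And>s. 0 \<le> r + s \<Longrightarrow> r + s \<le> R \<Longrightarrow> b\<^sup>2 + p\<^sub>2 * s - s\<^sup>2/2 \<le> G y (r + s)"
    using ball_sup_subgradient[OF sub cont balls(2) r] unfolding abc G_def by auto
  \<comment> \<open>The slope has a minus sign because the radius of the third ball will change by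
    \<open>- S\<close>.\<close>
  obtain p where p: "\<And>s. 0 \<le> r + s \<Longrightarrow> r + s \<le> R \<Longrightarrow> H z (r + s) \<le> c\<^sup>2 - p * s - s\<^sup>2/2"
  proof -
    obtain p where "\<And>s. 0 \<le> r + s \<Longrightarrow> r + s \<le> R \<Longrightarrow>
        ball_sup (\<lambda>z. - u z) z r + p * s - (-1)/2 * s\<^sup>2 \<le> ball_sup (\<lambda>z. - u z) z (r + s)"
      using ball_sup_subgradient[OF super contn balls(3) r] unfolding z_def by metis
    hence "H z (r + s) \<le> c\<^sup>2 - p * s - s\<^sup>2/2" if "0 \<le> r + s" "r + s \<le> R" for s
      using that unfolding abc H_def by fastforce
    thus ?thesis using that by blast
  qed
  \<comment> \<open>Radii changed by at most \<open>\<eta>\<close> stay in \<open>[0, R]\<close>,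
    which covers \<open>S\<close> because \<open>l + m \<le> 1\<close>; centres moved by at most
    \<open>\<eta>\<close> stay in \<open>\<Omega>\<close>.\<close>
  define \<eta> where "\<eta> = min r (R - r)"
  have \<eta>: "\<eta> > 0" "\<eta> \<le> r" "r + \<eta> \<le> R" using r by (auto simp: \<eta>_def)
  have "l * a + m * b \<le> c"
  proof (rule weighted_sqrt_parabola_max[OF abc(4-6) lm(1,2) \<eta>(1)])
    fix s\<^sub>1 s\<^sub>2 :: real
    assume s: "\<bar>s\<^sub>1\<bar> < \<eta>" "\<bar>s\<^sub>2\<bar> < \<eta>" and sgn: "(0 \<le> s\<^sub>1 \<and> 0 \<le> s\<^sub>2) \<or> (s\<^sub>1 \<le> 0 \<and> s\<^sub>2 \<le> 0)"
    define S where "S = l * s\<^sub>1 + m * s\<^sub>2"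
    have "\<bar>S\<bar> \<le> l * \<bar>s\<^sub>1\<bar> + m * \<bar>s\<^sub>2\<bar>"
      unfolding S_def using lm by (metis abs_mult abs_of_nonneg abs_triangle_ineq)
    also have "\<dots> \<le> l * \<eta> + m * \<eta>" using s lm by (intro add_mono mult_left_mono) auto
    also have "\<dots> \<le> \<eta>" using lm(3) \<eta>(1) by (metis distrib_right mult_left_le_one_le mult.commute less_imp_le lm(1) lm(2) add_nonneg_nonneg)
    finally have S: "\<bar>S\<bar> \<le> \<eta>" .
    have rng: "0 \<le> r + s\<^sub>1" "r + s\<^sub>1 \<le> R" "0 \<le> r + s\<^sub>2" "r + s\<^sub>2 \<le> R" "0 \<le> r - S" "r - S \<le> R"
      using s S \<eta> by linarith+
    obtain x' where x': "x' \<in> cball x (r + s\<^sub>1)" "u x' = G x (r + s\<^sub>1)" using Gatt[of x "r + s\<^sub>1"] rng by blast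
    obtain y' where y': "y' \<in> cball y (r + s\<^sub>2)" "u y' = G y (r + s\<^sub>2)" using Gatt[of y "r + s\<^sub>2"] rng by blast
    obtain z' where z': "z' \<in> cball z (r - S)" "u z' = H z (r - S)" using Hatt[of z "r - S"] rng by blast
    have in1: "x' \<in> \<Omega>" "y' \<in> \<Omega>" "z' \<in> \<Omega>"
      using incl[of x "r + s\<^sub>1"] incl[of y "r + s\<^sub>2"] incl[of z "r - S"] x'(1) y'(1) z'(1) rng by blast+
    have mem: "x + d \<in> \<Omega>" "y + d \<in> \<Omega>" if "norm d \<le> \<eta>" for d
      using incl[of x \<eta>] incl[of y \<eta>] that \<eta> r by (auto simp: subset_iff dist_norm)
    have "\<exists>d\<^sub>1 d\<^sub>2. norm d\<^sub>1 \<le> \<eta> \<and> norm d\<^sub>2 \<le> \<eta> \<and> x' \<in> cball (x + d\<^sub>1) r \<and> y' \<in> cball (y + d\<^sub>2) r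
        \<and> z' \<in> cball (z + (l *\<^sub>R d\<^sub>1 + m *\<^sub>R d\<^sub>2)) r"
    proof (cases "0 \<le> s\<^sub>1 \<and> 0 \<le> s\<^sub>2")
      \<comment> \<open>The points \<open>x'\<close> and \<open>y'\<close> dictate the
        displacements. The third centre then moves by at most \<open>S\<close>, and its ball of
        radius \<open>r\<close> still contains the ball of radius \<open>r - S\<close> about
        \<open>z\<close>.\<close>
      case True
      obtain d\<^sub>1 where d1: "norm d\<^sub>1 \<le> 1" "x' \<in> cball (x + s\<^sub>1 *\<^sub>R d\<^sub>1) r"
        using cball_add_split[OF r(1) _ x'(1)] True by blast
      obtain d\<^sub>2 where d2: "norm d\<^sub>2 \<le> 1" "y' \<in> cball (y + s\<^sub>2 *\<^sub>R d\<^sub>2) r"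
        using cball_add_split[OF r(1) _ y'(1)] True by blast
      have n1: "norm (s\<^sub>1 *\<^sub>R d\<^sub>1) \<le> s\<^sub>1" "norm (s\<^sub>2 *\<^sub>R d\<^sub>2) \<le> s\<^sub>2"
        using True d1 d2 by (simp_all add: mult_left_le)
      have "norm (l *\<^sub>R (s\<^sub>1 *\<^sub>R d\<^sub>1) + m *\<^sub>R (s\<^sub>2 *\<^sub>R d\<^sub>2)) \<le> norm (l *\<^sub>R (s\<^sub>1 *\<^sub>R d\<^sub>1)) + norm (m *\<^sub>R (s\<^sub>2 *\<^sub>R d\<^sub>2))"
        by (rule norm_triangle_ineq)
      also have "\<dots> = l * norm (s\<^sub>1 *\<^sub>R d\<^sub>1) + m * norm (s\<^sub>2 *\<^sub>R d\<^sub>2)" using lm by (simp add: abs_mult)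
      also have "\<dots> \<le> S" unfolding S_def by (intro add_mono mult_left_mono n1 lm)
      finally have "z' \<in> cball (z + (l *\<^sub>R (s\<^sub>1 *\<^sub>R d\<^sub>1) + m *\<^sub>R (s\<^sub>2 *\<^sub>R d\<^sub>2))) r"
        by (rule cball_shift_mem[OF z'(1)])
      thus ?thesis using d1 d2 n1 s by (meson abs_ge_self order_trans less_imp_le)
    next
      \<comment> \<open>Now the third ball grows and \<open>z'\<close> dictates a direction
        \<open>d\<close>. Moving the first two centres along the same \<open>d\<close>, by
        \<open>- s\<^sub>1\<close> and \<open>- s\<^sub>2\<close>, moves the third by exactly
        \<open>- S\<close> along \<open>d\<close>.\<close>
      case False
      hence neg: "s\<^sub>1 \<le> 0" "s\<^sub>2 \<le> 0" using sgn by auto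
      hence "S \<le> 0" unfolding S_def using lm by (simp add: add_nonpos_nonpos mult_nonneg_nonpos)
      then obtain d where d: "norm d \<le> 1" "z' \<in> cball (z + (- S) *\<^sub>R d) r"
        using cball_add_split[OF r(1), of "- S" z' z] z'(1) by auto
      have n: "norm ((- s) *\<^sub>R d) \<le> - s" if "s \<le> 0" for s
        using mult_left_le[OF d(1), of "- s"] that by simp
      have "x' \<in> cball (x + (- s\<^sub>1) *\<^sub>R d) r"
        by (rule cball_shift_mem[OF _ n[OF neg(1)]]) (use x'(1) in simp)
      moreover have "y' \<in> cball (y + (- s\<^sub>2) *\<^sub>R d) r"
        by (rule cball_shift_mem[OF _ n[OF neg(2)]]) (use y'(1) in simp)
      moreover have "(- S) *\<^sub>R d = l *\<^sub>R ((- s\<^sub>1) *\<^sub>R d) + m *\<^sub>R ((- s\<^sub>2) *\<^sub>R d)"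
        by (simp add: S_def algebra_simps)
      moreover have "norm ((- s\<^sub>1) *\<^sub>R d) \<le> \<eta>" "norm ((- s\<^sub>2) *\<^sub>R d) \<le> \<eta>"
        using n[OF neg(1)] n[OF neg(2)] s by linarith+
      ultimately show ?thesis using d(2) by metis
    qed
    then obtain d\<^sub>1 d\<^sub>2 where d: "norm d\<^sub>1 \<le> \<eta>" "norm d\<^sub>2 \<le> \<eta>" "x' \<in> cball (x + d\<^sub>1) r" "y' \<in> cball (y + d\<^sub>2) r"
        "z' \<in> cball (z + (l *\<^sub>R d\<^sub>1 + m *\<^sub>R d\<^sub>2)) r" by blast
    have "z + (l *\<^sub>R d\<^sub>1 + m *\<^sub>R d\<^sub>2) = l *\<^sub>R (x + d\<^sub>1) + m *\<^sub>R (y + d\<^sub>2) + n" by (simp add: z_def algebra_simps)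
    hence "l * sqrt (u x') + m * sqrt (u y') - sqrt (u z') \<le> l * sqrt (u x\<^sub>1) + m * sqrt (u y\<^sub>1) - sqrt (u z\<^sub>1)"
      using max[of "x + d\<^sub>1" "y + d\<^sub>2" x' y' z'] mem d in1 by simp
    moreover have "l * sqrt (a\<^sup>2 + p\<^sub>1 * s\<^sub>1 - s\<^sub>1\<^sup>2/2) + m * sqrt (b\<^sup>2 + p\<^sub>2 * s\<^sub>2 - s\<^sub>2\<^sup>2/2)
      - sqrt (c\<^sup>2 + p * S - S\<^sup>2/2) \<le> l * sqrt (u x') + m * sqrt (u y') - sqrt (u z')"
      unfolding x' y' z'
      using p1[of s\<^sub>1] p2[of s\<^sub>2] p[of "- S"] s S \<eta>
      by (intro diff_mono add_mono mult_left_mono real_sqrt_le_mono lm) auto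
    ultimately show "l * sqrt (a\<^sup>2 + p\<^sub>1 * s\<^sub>1 - s\<^sub>1\<^sup>2/2) + m * sqrt (b\<^sup>2 + p\<^sub>2 * s\<^sub>2 - s\<^sub>2\<^sup>2/2)
      - sqrt (c\<^sup>2 + p * (l * s\<^sub>1 + m * s\<^sub>2) - (l * s\<^sub>1 + m * s\<^sub>2)\<^sup>2/2) \<le> l * a + m * b - c"
      using M unfolding S_def by linarith
  qed
  thus ?thesis using M by linarith
qed

section \<open>Existence of an interior maximum\<close>

text \<open>
  The weight \<open>l = 0\<close>, with \<open>n\<close> a multiple of a boundary point, is the case of a fixed boundary point; \<open>x\<close> is then
  a dummy variable and is replaced by \<open>y\<close> in the proof.
\<close>

lemma weighted_sqrt_concave_of_interior:
  fixes u :: "real^'n \<Rightarrow> real"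
  assumes "open \<Omega>" "bounded \<Omega>"
    and sub: "jet_sub \<Omega> 1 u" and super: "jet_sub \<Omega> (-1) (\<lambda>z. - u z)"
    and cont: "continuous_on (closure \<Omega>) u" and upos: "\<And>z. z \<in> \<Omega> \<Longrightarrow> 0 < u z"
    and lm: "0 \<le> l" "0 \<le> m" "l + m \<le> 1"
    and mid: "\<And>x y. x \<in> closure \<Omega> \<Longrightarrow> y \<in> closure \<Omega> \<Longrightarrow> l *\<^sub>R x + m *\<^sub>R y + n \<in> closure \<Omega>"
    and int: "\<And>x y. x \<in> closure \<Omega> \<Longrightarrow> y \<in> closure \<Omega> \<Longrightarrow>
      sqrt (u (l *\<^sub>R x + m *\<^sub>R y + n)) < l * sqrt (u x) + m * sqrt (u y) \<Longrightarrow>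
      y \<in> \<Omega> \<and> (l \<noteq> 0 \<longrightarrow> x \<in> \<Omega>) \<and> l *\<^sub>R x + m *\<^sub>R y + n \<in> \<Omega>"
    and x0: "x\<^sub>0 \<in> closure \<Omega>" and y0: "y\<^sub>0 \<in> closure \<Omega>"
  shows "l * sqrt (u x\<^sub>0) + m * sqrt (u y\<^sub>0) \<le> sqrt (u (l *\<^sub>R x\<^sub>0 + m *\<^sub>R y\<^sub>0 + n))"
proof (rule ccontr)
  define K where "K = closure \<Omega>"
  define w where "w z = sqrt (u z)" for z
  define \<mu> where "\<mu> p = l *\<^sub>R fst p + m *\<^sub>R snd p + n" for p :: "(real^'n) \<times> (real^'n)"
  define F where "F p = l * w (fst p) + m * w (snd p) - w (\<mu> p)" for p
  define M where "M = F (x\<^sub>0, y\<^sub>0)"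
  assume "\<not> l * sqrt (u x\<^sub>0) + m * sqrt (u y\<^sub>0) \<le> sqrt (u (l *\<^sub>R x\<^sub>0 + m *\<^sub>R y\<^sub>0 + n))"
  hence M0: "M > 0" by (simp add: M_def F_def w_def \<mu>_def)
  have K: "compact K" "\<Omega> \<subseteq> K" using assms(2) closure_subset by (auto simp: K_def)
  have cw: "continuous_on K w" unfolding w_def K_def by (intro continuous_intros cont)
  have "uniformly_continuous_on K w" using compact_uniformly_continuous cw K by blast
  \<comment> \<open>With \<open>l + m \<le> 1\<close>, an oscillation below \<open>M/8\<close> means
    that passing from points to their centres costs at most \<open>M/4\<close>, so the value of
    \<open>F\<close> at the centres stays above the threshold \<open>M/4\<close> of the set
    \<open>G\<close>.\<close>
  then obtain \<delta> where \<delta>: "\<delta> > 0" "\<And>z z'. z \<in> K \<Longrightarrow> z' \<in> K \<Longrightarrow> dist z z' < \<delta> \<Longrightarrow> \<bar>w z - w z'\<bar> < M/8"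
    using M0 unfolding uniformly_continuous_on_def dist_real_def
    by (metis abs_minus_commute zero_less_divide_iff zero_less_numeral)
  have \<mu>K: "\<mu> p \<in> K" if "p \<in> K \<times> K" for p
    using mid that by (auto simp: \<mu>_def K_def)
  have c\<mu>: "continuous_on S \<mu>" for S unfolding \<mu>_def by (intro continuous_intros)
  have cF: "continuous_on (K \<times> K) F"
    unfolding F_def
    by (intro continuous_intros continuous_on_compose2[OF cw] c\<mu>) (use \<mu>K in auto)
  \<comment> \<open>On this compact set \<open>F\<close> is positive, so \<open>int\<close> places
    the relevant points in \<open>\<Omega>\<close>; compactness makes their distance to the
    complement uniform.\<close>
  define G where "G = {p \<in> K \<times> K. M/4 \<le> F p}"
  have "closed G" unfolding G_def
    by (intro continuous_on_closed_Collect_le cF continuous_intros) (simp add: K compact_imp_closed compact_Times)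
  moreover have "bounded G"
    by (rule bounded_subset[of "K \<times> K"]) (auto simp: G_def K compact_imp_bounded compact_Times)
  ultimately have G: "compact G" by (simp add: compact_eq_bounded_closed)
  define f where "f p = (if l = 0 then snd p else fst p)" for p :: "(real^'n) \<times> (real^'n)"
  have GO: "snd p \<in> \<Omega>" "f p \<in> \<Omega>" "\<mu> p \<in> \<Omega>" if "p \<in> G" for p
  proof -
    have "0 < F p" using that M0 by (auto simp: G_def)
    hence "snd p \<in> \<Omega> \<and> (l \<noteq> 0 \<longrightarrow> fst p \<in> \<Omega>) \<and> \<mu> p \<in> \<Omega>"
      using int[of "fst p" "snd p"] that by (auto simp: G_def K_def F_def w_def \<mu>_def)
    thus "snd p \<in> \<Omega>" "f p \<in> \<Omega>" "\<mu> p \<in> \<Omega>" by (auto simp: f_def)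
  qed
  have "\<exists>d>0. \<forall>p\<in>G. cball (g p) d \<subseteq> \<Omega>" if "continuous_on G g" "\<And>p. p \<in> G \<Longrightarrow> g p \<in> \<Omega>"
    for g :: "(real^'n) \<times> (real^'n) \<Rightarrow> real^'n"
    using compact_subset_open_imp_cball_epsilon_subset[OF compact_continuous_image[OF that(1) G] assms(1)] that(2)
    by (metis (no_types, lifting) UN_subset_iff image_eqI image_subsetI)
  moreover have "continuous_on G f" unfolding f_def by (cases "l = 0") (auto intro: continuous_intros)
  moreover have "continuous_on G snd" by (intro continuous_intros)
  ultimately obtain d\<^sub>1 d\<^sub>2 d\<^sub>3 where d: "d\<^sub>1 > 0" "d\<^sub>2 > 0" "d\<^sub>3 > 0"
      "\<And>p. p \<in> G \<Longrightarrow> cball (f p) d\<^sub>1 \<subseteq> \<Omega>" "\<And>p. p \<in> G \<Longrightarrow> cball (snd p) d\<^sub>2 \<subseteq> \<Omega>"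
      "\<And>p. p \<in> G \<Longrightarrow> cball (\<mu> p) d\<^sub>3 \<subseteq> \<Omega>"
    using GO c\<mu> by metis
  define R where "R = min d\<^sub>1 (min d\<^sub>2 d\<^sub>3)"
  have R: "R > 0" "\<And>p. p \<in> G \<Longrightarrow> cball (f p) R \<subseteq> \<Omega>" "\<And>p. p \<in> G \<Longrightarrow> cball (snd p) R \<subseteq> \<Omega>"
      "\<And>p. p \<in> G \<Longrightarrow> cball (\<mu> p) R \<subseteq> \<Omega>"
  proof -
    show "R > 0" using d by (simp add: R_def)
    have "cball z R \<subseteq> cball z d\<^sub>1 \<inter> cball z d\<^sub>2 \<inter> cball z d\<^sub>3" for z :: "real^'n" by (auto simp: R_def)
    thus "cball (f p) R \<subseteq> \<Omega>" "cball (snd p) R \<subseteq> \<Omega>" "cball (\<mu> p) R \<subseteq> \<Omega>" if "p \<in> G" for p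
      using d(4-6)[OF that] by blast+
  qed
  define r where "r = min R \<delta> / 2"
  have r: "0 < r" "r < R" "r < \<delta>" using R \<delta> by (auto simp: r_def min_def)
  \<comment> \<open>A configuration is a pair of centres, a point near each of them, and a point
    near the image of the pair under \<open>\<mu>\<close>. The objective \<open>V\<close> sees only
    the points, so maximising it over \<open>T\<close> optimises over centres and balls at
    once.\<close>
  define T where "T = {p \<in> (K \<times> K) \<times> (K \<times> K) \<times> K.
     max (dist (fst (fst p)) (fst (fst (snd p)))) (max (dist (snd (fst p)) (snd (fst (snd p)))) (dist (\<mu> (fst p)) (snd (snd p)))) \<le> r}"
  define V where "V q = l * w (fst (fst q)) + m * w (snd (fst q)) - w (snd q)" for q :: "((real^'n) \<times> (real^'n)) \<times> (real^'n)"
  have "closed T" unfolding T_def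
    by (intro continuous_on_closed_Collect_le continuous_intros continuous_on_compose2[OF c\<mu>[of UNIV]])
       (auto simp: K compact_imp_closed compact_Times)
  moreover have "bounded T"
    by (rule bounded_subset[of "(K \<times> K) \<times> (K \<times> K) \<times> K"]) (auto simp: T_def K compact_imp_bounded compact_Times)
  ultimately have "compact T" by (simp add: compact_eq_bounded_closed)
  moreover have T0: "((x\<^sub>0, y\<^sub>0), (x\<^sub>0, y\<^sub>0), \<mu> (x\<^sub>0, y\<^sub>0)) \<in> T"
    using x0 y0 r \<mu>K[of "(x\<^sub>0, y\<^sub>0)"] by (auto simp: T_def K_def)
  moreover have "continuous_on T (\<lambda>p. V (snd p))"
    unfolding V_def by (intro continuous_intros continuous_on_compose2[OF cw]) (auto simp: T_def)
  ultimately obtain p where p: "p \<in> T" and pmax: "\<And>q. q \<in> T \<Longrightarrow> V (snd q) \<le> V (snd p)"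
    using continuous_attains_sup[of T "\<lambda>p. V (snd p)"] by blast
  obtain x y x\<^sub>1 y\<^sub>1 z\<^sub>1 where pe: "p = ((x, y), (x\<^sub>1, y\<^sub>1), z\<^sub>1)" by (metis prod.collapse)
  have pK: "x \<in> K" "y \<in> K" "x\<^sub>1 \<in> K" "y\<^sub>1 \<in> K" "z\<^sub>1 \<in> K"
    "dist x x\<^sub>1 \<le> r" "dist y y\<^sub>1 \<le> r" "dist (\<mu> (x, y)) z\<^sub>1 \<le> r"
    using p by (auto simp: T_def pe)
  have VM: "M \<le> V ((x\<^sub>1, y\<^sub>1), z\<^sub>1)" using pmax[OF T0] by (simp add: pe M_def F_def V_def)
  have "(x, y) \<in> G"
  proof -
    have "\<bar>w x - w x\<^sub>1\<bar> < M/8" "\<bar>w y - w y\<^sub>1\<bar> < M/8" "\<bar>w (\<mu> (x,y)) - w z\<^sub>1\<bar> < M/8"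
      by (rule \<delta>(2); use pK \<mu>K[of "(x,y)"] r in auto)+
    hence 1: "w x\<^sub>1 \<le> w x + M/8" "w y\<^sub>1 \<le> w y + M/8" "w (\<mu> (x,y)) \<le> w z\<^sub>1 + M/8"
      by linarith+
    have "l * w x\<^sub>1 \<le> l * (w x + M/8)" "m * w y\<^sub>1 \<le> m * (w y + M/8)"
      using 1 lm by (simp_all add: mult_left_mono)
    hence "M \<le> F (x, y) + (l + m) * (M/8) + M/8" using VM 1(3) by (simp add: F_def V_def algebra_simps add_divide_distrib)
    moreover have "(l + m) * (M/8) \<le> 1 * (M/8)" using lm M0 by (intro mult_right_mono) auto
    ultimately have "M/4 \<le> F (x, y)" using M0 by linarith
    thus ?thesis using pK by (simp add: G_def)
  qed
  note xyG = this
  define X where "X = f (x, y)"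
  define X\<^sub>1 where "X\<^sub>1 = f (x\<^sub>1, y\<^sub>1)"
  have X: "l *\<^sub>R X = l *\<^sub>R x" "l * sqrt (u X\<^sub>1) = l * sqrt (u x\<^sub>1)" by (auto simp: X_def X\<^sub>1_def f_def)
  have "l * sqrt (u X\<^sub>1) + m * sqrt (u y\<^sub>1) \<le> sqrt (u z\<^sub>1)"
  proof (rule sqrt_concavity_local_max[OF sub super _ upos lm r(1,2)])
    show "continuous_on \<Omega> u" using cont continuous_on_subset closure_subset by blast
    show "cball X R \<subseteq> \<Omega>" "cball y R \<subseteq> \<Omega>" "cball (l *\<^sub>R X + m *\<^sub>R y + n) R \<subseteq> \<Omega>"
      using R(2-4)[OF xyG] by (simp_all add: X_def[symmetric] X \<mu>_def)
    show "X\<^sub>1 \<in> cball X r" "y\<^sub>1 \<in> cball y r" "z\<^sub>1 \<in> cball (l *\<^sub>R X + m *\<^sub>R y + n) r"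
      using pK by (auto simp: X) (auto simp: X_def X\<^sub>1_def f_def \<mu>_def)
    fix a b a' b' c'
    assume *: "a \<in> \<Omega>" "b \<in> \<Omega>" "a' \<in> \<Omega>" "b' \<in> \<Omega>" "c' \<in> \<Omega>"
      "a' \<in> cball a r" "b' \<in> cball b r" "c' \<in> cball (l *\<^sub>R a + m *\<^sub>R b + n) r"
    have "((a, b), (a', b'), c') \<in> T" using * K(2) by (auto simp: T_def \<mu>_def)
    from pmax[OF this] show "l * sqrt (u a') + m * sqrt (u b') - sqrt (u c')
        \<le> l * sqrt (u X\<^sub>1) + m * sqrt (u y\<^sub>1) - sqrt (u z\<^sub>1)"
      unfolding X by (simp add: pe V_def w_def)
  qed
  hence "V ((x\<^sub>1, y\<^sub>1), z\<^sub>1) \<le> 0" unfolding X by (simp add: V_def w_def)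
  thus False using VM M0 by linarith
qed

section \<open>Positivity and the concavity theorem\<close>

text \<open>An interior minimum of \<open>u\<close> would be a local maximum of \<open>- u\<close>,
  which the jet condition forbids. Hence the minimum over the closure is the boundary value
  \<open>0\<close>, and a zero inside \<open>\<Omega>\<close> would again be an interior
  minimum.\<close>

lemma supersolution_pos:
  fixes u :: "real^'n \<Rightarrow> real"
  assumes "bounded \<Omega>" "jet_sub \<Omega> (-1) (\<lambda>z. - u z)" "open \<Omega>"
    and "continuous_on (closure \<Omega>) u" "\<And>x. x \<in> frontier \<Omega> \<Longrightarrow> u x = 0" "x \<in> \<Omega>"
  shows "0 < u x"
proof -
  have no_min: "\<not> (\<forall>z\<in>\<Omega>. u y \<le> u z)" if "y \<in> \<Omega>" for y
  proof
    assume "\<forall>z\<in>\<Omega>. u y \<le> u z"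
    hence "\<forall>\<^sub>F z in nhds y. - u z \<le> - u y"
      using eventually_nhds_in_open[OF assms(3) that] by (auto elim: eventually_mono)
    thus False using jet_sub_no_local_max[OF assms(2) _ that] by simp
  qed
  have K: "compact (closure \<Omega>)" "\<Omega> \<subseteq> closure \<Omega>" using assms(1) closure_subset by auto
  then obtain y where y: "y \<in> closure \<Omega>" "\<And>z. z \<in> closure \<Omega> \<Longrightarrow> u y \<le> u z"
    using continuous_attains_inf[of "closure \<Omega>" u] assms(4,6) by blast
  hence "y \<notin> \<Omega>" using no_min K by blast
  hence "u y = 0" using y(1) assms(3,5) by (simp add: frontier_def interior_open)
  hence nonneg: "0 \<le> u z" if "z \<in> \<Omega>" for z using y(2)[of z] K that by auto
  have "u x \<noteq> 0" using no_min[OF assms(6)] nonneg by auto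
  thus ?thesis using nonneg[OF assms(6)] by simp
qed

theorem theorem6:
  fixes \<Omega> :: "(real^'n) set" and u :: "real^'n \<Rightarrow> real"
  assumes "open \<Omega>" and "bounded \<Omega>" and "convex \<Omega>"
    and "dirichlet_viscosity_solution \<Omega> (\<lambda>x. 1) u"
  shows "concave_on \<Omega> (\<lambda>x. sqrt (u x))"
proof -
  have cont: "continuous_on (closure \<Omega>) u" and bdry: "\<And>x. x \<in> frontier \<Omega> \<Longrightarrow> u x = 0"
    and sol: "viscosity_subsolution \<Omega> (\<lambda>x. 1) u" "viscosity_supersolution \<Omega> (\<lambda>x. 1) u"
    using assms(4) by (auto simp: dirichlet_viscosity_solution_def viscosity_solution_def)
  have "bounded (u ` closure \<Omega>)"
    using assms(2) cont compact_continuous_image compact_imp_bounded compact_closure by blast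
  hence bd: "bounded (u ` \<Omega>)" using bounded_subset closure_subset image_mono by metis
  have sub: "jet_sub \<Omega> 1 u" by (rule subsolution_jet_sub[OF assms(2) bd sol(1)])
  have super: "jet_sub \<Omega> (-1) (\<lambda>z. - u z)" by (rule supersolution_jet_sub[OF assms(2) bd sol(2)])
  have pos: "0 < u x" if "x \<in> \<Omega>" for x by (rule supersolution_pos[OF assms(2) super assms(1) cont bdry that])
  have cl: "x \<in> \<Omega> \<or> x \<in> frontier \<Omega>" if "x \<in> closure \<Omega>" for x
    using that assms(1) by (auto simp: frontier_def interior_open)
  have nonneg: "0 \<le> u x" if "x \<in> closure \<Omega>" for x
    using cl[OF that] pos bdry by force
  have convK: "l *\<^sub>R x + m *\<^sub>R y \<in> closure \<Omega>"
    if "x \<in> closure \<Omega>" "y \<in> closure \<Omega>" "0 \<le> l" "0 \<le> m" "l + m = 1" for x y l m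
    using convex_closure[OF assms(3)] that by (simp add: convex_def)
  note main = weighted_sqrt_concave_of_interior[OF assms(1,2) sub super cont pos]
  \<comment> \<open>Concavity along segments from a boundary point, where \<open>u\<close> vanishes:
    the previous result with weights \<open>0\<close> and \<open>m\<close> and the fixed vector
    \<open>n = l *\<^sub>R x\<close>.\<close>
  have star: "m * sqrt (u y) \<le> sqrt (u (l *\<^sub>R x + m *\<^sub>R y))"
    if x: "x \<in> frontier \<Omega>" and y: "y \<in> closure \<Omega>" and lm: "0 \<le> l" "0 \<le> m" "l + m = 1" for x y l m
  proof -
    have xc: "x \<in> closure \<Omega>" using x by (simp add: frontier_def)
    have "0 * sqrt (u y) + m * sqrt (u y) \<le> sqrt (u (0 *\<^sub>R y + m *\<^sub>R y + l *\<^sub>R x))"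
    proof (rule main)
      fix a b assume ab: "a \<in> closure \<Omega>" "b \<in> closure \<Omega>"
      show mc: "0 *\<^sub>R a + m *\<^sub>R b + l *\<^sub>R x \<in> closure \<Omega>"
        using convK[OF xc ab(2) lm] by (simp add: add.commute)
      assume "sqrt (u (0 *\<^sub>R a + m *\<^sub>R b + l *\<^sub>R x)) < 0 * sqrt (u a) + m * sqrt (u b)"
      moreover have "0 \<le> sqrt (u (0 *\<^sub>R a + m *\<^sub>R b + l *\<^sub>R x))" using nonneg[OF mc] by simp
      ultimately have mb: "0 < m * sqrt (u b)" by linarith
      hence "u b \<noteq> 0" "m > 0" using lm by (auto simp: less_le)
      hence b: "b \<in> \<Omega>" using cl[OF ab(2)] bdry by auto
      \<comment> \<open>By convexity every point of the segment from \<open>x\<close> to the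
        interior point \<open>b\<close>, except possibly \<open>x\<close> itself, is
        interior.\<close>
      have "x - m *\<^sub>R (x - b) \<in> interior \<Omega>"
        by (rule mem_interior_closure_convex_shrink[OF assms(3) _ xc \<open>m > 0\<close>]) (use b lm assms(1) in \<open>auto simp: interior_open\<close>)
      moreover have "x - m *\<^sub>R (x - b) = 0 *\<^sub>R a + m *\<^sub>R b + l *\<^sub>R x"
        using lm(3) by (simp add: algebra_simps flip: scaleR_add_left)
      ultimately show "b \<in> \<Omega> \<and> (0 \<noteq> (0::real) \<longrightarrow> a \<in> \<Omega>) \<and> 0 *\<^sub>R a + m *\<^sub>R b + l *\<^sub>R x \<in> \<Omega>"
        using b interior_subset by auto
    qed (use lm y in auto)
    thus ?thesis by (simp add: add.commute)
  qed
  show ?thesis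
    unfolding concave_on_iff
  proof (intro conjI ballI allI impI assms(3))
    fix x y l m assume xy: "x \<in> \<Omega>" "y \<in> \<Omega>" and lm: "(0::real) \<le> l" "(0::real) \<le> m" "l + m = 1"
    have "l * sqrt (u x) + m * sqrt (u y) \<le> sqrt (u (l *\<^sub>R x + m *\<^sub>R y + 0))"
    proof (rule main)
      fix a b assume ab: "a \<in> closure \<Omega>" "b \<in> closure \<Omega>"
      show "l *\<^sub>R a + m *\<^sub>R b + 0 \<in> closure \<Omega>" using convK[OF ab lm] by simp
      assume less: "sqrt (u (l *\<^sub>R a + m *\<^sub>R b + 0)) < l * sqrt (u a) + m * sqrt (u b)"
      \<comment> \<open>If \<open>a\<close> were on the boundary, its term would vanish and
        \<open>star\<close> would contradict the strict inequality; the same holds for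
        \<open>b\<close> with the weights exchanged.\<close>
      have a: "a \<in> \<Omega>" using cl[OF ab(1)] star[OF _ ab(2) lm, of a] less bdry by force
      have b: "b \<in> \<Omega>" using cl[OF ab(2)] star[OF _ ab(1) lm(2,1), of b] less bdry lm
        by (force simp: add.commute)
      show "b \<in> \<Omega> \<and> (l \<noteq> 0 \<longrightarrow> a \<in> \<Omega>) \<and> l *\<^sub>R a + m *\<^sub>R b + 0 \<in> \<Omega>"
        using a b assms(3) lm by (simp add: convex_def)
    qed (use xy lm closure_subset in auto)
    thus "l * sqrt (u x) + m * sqrt (u y) \<le> sqrt (u (l *\<^sub>R x + m *\<^sub>R y))" by simp
  qed
qed

end
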